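(* Let $S=\{\mu_i\}_{i\in\mathbb{N}}\subset\mathbb{R}_{>0}$ be any sequence with $\lim_{i\to\infty}\mu_i=0$, and let $t\in\overline{\Omega}^S=\Omega^0\cap\bigcap_{i\in\mathbb{N}}\Omega^{\mu_i}$. Then $$\lim_{i\to\infty}\left\|\widetilde{\mathcal{U}}_t^{\mu_i}\begin{pmatrix}x\\ p\end{pmatrix}-\mathcal{U}_t\begin{pmatrix}x\\ p\end{pmatrix}\right\|_{\mathscr{Y}}=0\qquad\text{for all }(x,p)\in\mathscr{Y}=\mathscr{X}_1\times\mathscr{X}.$$
   Context: $\mathscr{X}$ is a real $L_2$-space with inner product $\langle\cdot,\cdot\rangle$ and norm $\|\cdot\|$. $\Lambda$ is a linear, unbounded, positive, self-adjoint operator with domain $\mathscr{X}_2=\mathrm{dom}(\Lambda)$ dense in $\mathscr{X}$ and compact inverse $\Lambda^{-1}\in\mathcal{L}(\mathscr{X})$. $\Lambda^{1/2}$ is its unique positive self-adjoint square root, and $\mathscr{X}_1=\mathrm{dom}(\Lambda^{1/2})$ is a Hilbert space with $\langle x,\xi\rangle_1=\langle\Lambda^{1/2}x,\Lambda^{1/2}\xi\rangle$ and norm $\|\cdot\|_1$. $\{\varphi_n\}_{n\in\mathbb{N}}$ is an orthonormal basis of $\mathscr{X}$ of eigenvectors of $\Lambda$, $\Lambda\varphi_n=\lambda_n\varphi_n$, with $0<\lambda_1\le\lambda_2\le\cdots\to\infty$ (repeated according to multiplicity), and $\tilde\varphi_n=\varphi_n/\sqrt{\lambda_n}$, an orthonormal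 basis of $\mathscr{X}_1$. $\mathscr{Y}$ carries the inner product $\langle(x,p),(\xi,\pi)\rangle_{\mathscr{Y}}=\langle x,\xi\rangle_1+\langle p,\pi\rangle$ and associated norm $\|\cdot\|_{\mathscr{Y}}$. Exact group: $\{\mathcal{U}_t\}_{t\in\mathbb{R}}$ is the strongly continuous group of bounded linear operators on $\mathscr{Y}$ generated by $$\mathcal{A}=\begin{pmatrix}0&\mathcal{I}\\-\Lambda&0\end{pmatrix},\qquad \mathrm{dom}(\mathcal{A})=\mathscr{X}_2\times\mathscr{X}_1.$$ For $\mu\ge0$: $\omega_n^\mu=\sqrt{\lambda_n/(1+\mu^2\lambda_n)}$ and $\Omega^\mu=\mathbb{R}_{>0}\setminus\{t_{n,j,k}^\mu\}_{n\in\mathbb{N}\cup\{\infty\},\,j,k\in\mathbb{N}}$, where $t_{n,j,k}^\mu=\frac jk\,\frac\pi2\,\frac1{\omega_n^\mu}$ for $n\in\mathbb{N}$ and $t_{\infty,j,k}^\mu=\frac jk\,\frac\pi2\,\mu$. For $\mu>0$: $\mathcal{I}_\mu=(\mathcal{I}+\mu^2\Lambda)^{-1}$, with positive square root $\mathcal{I}_\mu^{1/2}\in\mathcal{L}(\mathscr{X};\mathscr{X}_1)$, and $\mathcal{E}_\mu=\Lambda^{1/2}\mathcal{I}_\mu^{1/2}\Lambda^{1/2}\in\mathcal{L}(\mathscr{X}_1;\mathscr{X})$, which is boundedly invertible. For $t\in\Omega^\mu$, define on $\mathscr{X}_1$ $$\widetilde{\mathcal{P}}_t^\mu\xi=\sum_{n=1}^\infty\frac{-1}{\omega_n^\mu\tan(\omega_n^\mu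 t)}\langle\xi,\tilde\varphi_n\rangle_1\tilde\varphi_n,\qquad \widetilde{\mathcal{Q}}_t^\mu\xi=\sum_{n=1}^\infty\frac{1}{\omega_n^\mu\sin(\omega_n^\mu t)}\langle\xi,\tilde\varphi_n\rangle_1\tilde\varphi_n,$$ and the long horizon prototype $$\widetilde{\mathcal{U}}_t^\mu=\begin{pmatrix}-(\widetilde{\mathcal{Q}}_t^\mu)^{-1}\widetilde{\mathcal{P}}_t^\mu & (\widetilde{\mathcal{Q}}_t^\mu)^{-1}\mathcal{E}_\mu^{-1}\\ -\mathcal{E}_\mu\widetilde{\mathcal{Q}}_t^\mu\left(\mathcal{I}-[(\widetilde{\mathcal{Q}}_t^\mu)^{-1}\widetilde{\mathcal{P}}_t^\mu]^2\right) & -\mathcal{E}_\mu\widetilde{\mathcal{P}}_t^\mu(\widetilde{\mathcal{Q}}_t^\mu)^{-1}\mathcal{E}_\mu^{-1}\end{pmatrix}\in\mathcal{L}(\mathscr{Y}).$$ *)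

theory Defs
  imports "HOL-Analysis.Analysis" "HOL-Library.Extended_Nat"
begin

section \<open>Operators on a domain\<close>

text \<open>
  A possibly unbounded operator is a pair of a domain \<open>D\<close> and a total function \<open>A\<close>
  whose values outside \<open>D\<close> are irrelevant.
\<close>

definition linear_op :: "'v::real_vector set \<Rightarrow> ('v \<Rightarrow> 'w::real_vector) \<Rightarrow> bool" where
  "linear_op D A \<longleftrightarrow> subspace D \<and>
     (\<forall>x\<in>D. \<forall>y\<in>D. A (x + y) = A x + A y) \<and> (\<forall>c. \<forall>x\<in>D. A (c *\<^sub>R x) = c *\<^sub>R A x)"

definition unbounded_op :: "'a::real_normed_vector set \<Rightarrow> ('a \<Rightarrow> 'b::real_normed_vector) \<Rightarrow> bool" where
  "unbounded_op D A \<longleftrightarrow> \<not> (\<exists>K. \<forall>x\<in>D. norm (A x) \<le> K * norm x)"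

text \<open>The last conjunct says that the graph of the adjoint is the graph of \<open>A\<close>, domains included.\<close>

definition self_adjoint_op :: "'a::real_inner set \<Rightarrow> ('a \<Rightarrow> 'a) \<Rightarrow> bool" where
  "self_adjoint_op D A \<longleftrightarrow> linear_op D A \<and> closure D = UNIV \<and>
     (\<forall>y z. (\<forall>x\<in>D. A x \<bullet> y = x \<bullet> z) \<longleftrightarrow> y \<in> D \<and> z = A y)"

definition positive_op :: "'a::real_inner set \<Rightarrow> ('a \<Rightarrow> 'a) \<Rightarrow> bool" where
  "positive_op D A \<longleftrightarrow> (\<forall>x\<in>D. x \<noteq> 0 \<longrightarrow> A x \<bullet> x > 0)"

definition compact_op :: "('a::real_normed_vector \<Rightarrow> 'b::real_normed_vector) \<Rightarrow> bool" where
  "compact_op T \<longleftrightarrow> bounded_linear T \<and> compact (closure (T ` cball 0 1))"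

definition has_compact_inverse :: "'a::real_normed_vector set \<Rightarrow> ('a \<Rightarrow> 'a) \<Rightarrow> bool" where
  "has_compact_inverse D A \<longleftrightarrow> bij_betw A D UNIV \<and> compact_op (inv_into D A)"

text \<open>
  \<open>(E, B)\<close> is the positive self-adjoint square root of \<open>(D, A)\<close>; the composition \<open>B B\<close> has
  the natural domain \<open>{x \<in> E. B x \<in> E}\<close>, which has to be \<open>D\<close>.
\<close>

definition is_positive_sqrt ::
  "'a::real_inner set \<Rightarrow> ('a \<Rightarrow> 'a) \<Rightarrow> 'a set \<Rightarrow> ('a \<Rightarrow> 'a) \<Rightarrow> bool" where
  "is_positive_sqrt D A E B \<longleftrightarrow> self_adjoint_op E B \<and> positive_op E B \<and>
     {x \<in> E. B x \<in> E} = D \<and> (\<forall>x\<in>D. B (B x) = A x)"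

definition orthonormal_basis :: "(nat \<Rightarrow> 'a::real_inner) \<Rightarrow> bool" where
  "orthonormal_basis \<phi> \<longleftrightarrow>
     (\<forall>m n. \<phi> m \<bullet> \<phi> n = (if m = n then 1 else 0)) \<and> closure (span (range \<phi>)) = UNIV"

section \<open>Strongly continuous groups on a normed subspace\<close>

text \<open>
  Here \<open>V\<close> is a subspace with its own norm \<open>N\<close>, in general different from
  the norm of the ambient type.
\<close>

definition C0_group ::
  "'v::real_vector set \<Rightarrow> ('v \<Rightarrow> real) \<Rightarrow> (real \<Rightarrow> 'v \<Rightarrow> 'v) \<Rightarrow> bool" where
  "C0_group V N U \<longleftrightarrow>
     (\<forall>t. linear_op V (U t) \<and> U t ` V \<subseteq> V \<and> (\<exists>K. \<forall>v\<in>V. N (U t v) \<le> K * N v)) \<and>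
     (\<forall>v\<in>V. U 0 v = v) \<and>
     (\<forall>s t. \<forall>v\<in>V. U (s + t) v = U s (U t v)) \<and>
     (\<forall>v\<in>V. ((\<lambda>h. N (U h v - v)) \<longlongrightarrow> 0) (at 0))"

definition generated_by ::
  "'v::real_vector set \<Rightarrow> ('v \<Rightarrow> real) \<Rightarrow> (real \<Rightarrow> 'v \<Rightarrow> 'v) \<Rightarrow> 'v set \<Rightarrow> ('v \<Rightarrow> 'v) \<Rightarrow> bool" where
  "generated_by V N U D A \<longleftrightarrow> D \<subseteq> V \<and> A ` D \<subseteq> V \<and>
     (\<forall>v\<in>V. \<forall>z\<in>V.
        ((\<lambda>h. N ((1 / h) *\<^sub>R (U h v - v) - z)) \<longlongrightarrow> 0) (at 0) \<longleftrightarrow> v \<in> D \<and> z = A v)"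

section \<open>The spaces \<open>\<X>\<^sub>1\<close> and \<open>\<Y>\<close>\<close>

text \<open>
  Throughout, \<open>(X2, L)\<close> stands for \<open>\<Lambda>\<close> and \<open>(X1, R)\<close> for \<open>\<Lambda>\<close> to the power 1/2.
\<close>

definition inner1 :: "('a::real_inner \<Rightarrow> 'a) \<Rightarrow> 'a \<Rightarrow> 'a \<Rightarrow> real" where
  "inner1 R x \<xi> = R x \<bullet> R \<xi>"

definition norm1 :: "('a::real_inner \<Rightarrow> 'a) \<Rightarrow> 'a \<Rightarrow> real" where
  "norm1 R x = sqrt (inner1 R x x)"

definition innerY :: "('a::real_inner \<Rightarrow> 'a) \<Rightarrow> 'a \<times> 'a \<Rightarrow> 'a \<times> 'a \<Rightarrow> real" where
  "innerY R y \<eta> = inner1 R (fst y) (fst \<eta>) + snd y \<bullet> snd \<eta>"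

definition normY :: "('a::real_inner \<Rightarrow> 'a) \<Rightarrow> 'a \<times> 'a \<Rightarrow> real" where
  "normY R y = sqrt (innerY R y y)"

definition wave_op :: "('a::real_inner \<Rightarrow> 'a) \<Rightarrow> 'a \<times> 'a \<Rightarrow> 'a \<times> 'a" where
  "wave_op L y = (snd y, - L (fst y))"

section \<open>Frequencies and admissible times\<close>

text \<open>
  The eigenpairs are indexed from 0 here: \<open>lam n\<close> is the \<open>(n+1)\<close>-st eigenvalue.
\<close>

definition freq :: "(nat \<Rightarrow> real) \<Rightarrow> real \<Rightarrow> nat \<Rightarrow> real" where
  "freq lam \<mu> n = sqrt (lam n / (1 + \<mu>\<^sup>2 * lam n))"

definition crit_time :: "(nat \<Rightarrow> real) \<Rightarrow> real \<Rightarrow> enat \<Rightarrow> nat \<Rightarrow> nat \<Rightarrow> real" where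
  "crit_time lam \<mu> n j k =
     (case n of enat m \<Rightarrow> (real j / real k) * (pi / 2) * (1 / freq lam \<mu> m)
              | \<infinity> \<Rightarrow> (real j / real k) * (pi / 2) * \<mu>)"

definition Omega :: "(nat \<Rightarrow> real) \<Rightarrow> real \<Rightarrow> real set" where
  "Omega lam \<mu> = {0<..} - {crit_time lam \<mu> n j k | n j k. j \<ge> 1 \<and> k \<ge> 1}"

section \<open>The long horizon prototype\<close>

definition I_op :: "'a::real_inner set \<Rightarrow> ('a \<Rightarrow> 'a) \<Rightarrow> real \<Rightarrow> 'a \<Rightarrow> 'a" where
  "I_op X2 L \<mu> = inv_into X2 (\<lambda>x. x + \<mu>\<^sup>2 *\<^sub>R L x)"

definition I_half :: "'a::real_inner set \<Rightarrow> ('a \<Rightarrow> 'a) \<Rightarrow> real \<Rightarrow> 'a \<Rightarrow> 'a" where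
  "I_half X2 L \<mu> = (THE B. is_positive_sqrt UNIV (I_op X2 L \<mu>) UNIV B)"

definition E_op :: "'a::real_inner set \<Rightarrow> ('a \<Rightarrow> 'a) \<Rightarrow> ('a \<Rightarrow> 'a) \<Rightarrow> real \<Rightarrow> 'a \<Rightarrow> 'a" where
  "E_op X2 L R \<mu> x = R (I_half X2 L \<mu> (R x))"

text \<open>The sum of a series of elements of \<open>V\<close>, convergent with respect to the norm \<open>N\<close> of \<open>V\<close>.\<close>

definition series_on :: "'v::real_vector set \<Rightarrow> ('v \<Rightarrow> real) \<Rightarrow> (nat \<Rightarrow> 'v) \<Rightarrow> 'v" where
  "series_on V N f = (THE s. s \<in> V \<and> (\<lambda>m. N ((\<Sum>n<m. f n) - s)) \<longlonglongrightarrow> 0)"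

definition phi1 :: "(nat \<Rightarrow> 'a::real_inner) \<Rightarrow> (nat \<Rightarrow> real) \<Rightarrow> nat \<Rightarrow> 'a" where
  "phi1 \<phi> lam n = (1 / sqrt (lam n)) *\<^sub>R \<phi> n"

definition P_op ::
  "'a::real_inner set \<Rightarrow> ('a \<Rightarrow> 'a) \<Rightarrow> (nat \<Rightarrow> 'a) \<Rightarrow> (nat \<Rightarrow> real) \<Rightarrow> real \<Rightarrow> real \<Rightarrow> 'a \<Rightarrow> 'a" where
  "P_op X1 R \<phi> lam \<mu> t \<xi> = series_on X1 (norm1 R)
     (\<lambda>n. ((- 1) / (freq lam \<mu> n * tan (freq lam \<mu> n * t)) * inner1 R \<xi> (phi1 \<phi> lam n)) *\<^sub>R phi1 \<phi> lam n)"

definition Q_op ::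
  "'a::real_inner set \<Rightarrow> ('a \<Rightarrow> 'a) \<Rightarrow> (nat \<Rightarrow> 'a) \<Rightarrow> (nat \<Rightarrow> real) \<Rightarrow> real \<Rightarrow> real \<Rightarrow> 'a \<Rightarrow> 'a" where
  "Q_op X1 R \<phi> lam \<mu> t \<xi> = series_on X1 (norm1 R)
     (\<lambda>n. (1 / (freq lam \<mu> n * sin (freq lam \<mu> n * t)) * inner1 R \<xi> (phi1 \<phi> lam n)) *\<^sub>R phi1 \<phi> lam n)"

definition U_proto ::
  "'a::real_inner set \<Rightarrow> ('a \<Rightarrow> 'a) \<Rightarrow> 'a set \<Rightarrow> ('a \<Rightarrow> 'a) \<Rightarrow> (nat \<Rightarrow> 'a) \<Rightarrow> (nat \<Rightarrow> real) \<Rightarrow>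
   real \<Rightarrow> real \<Rightarrow> 'a \<times> 'a \<Rightarrow> 'a \<times> 'a" where
  "U_proto X2 L X1 R \<phi> lam \<mu> t y =
     (let P = P_op X1 R \<phi> lam \<mu> t;
          Q = Q_op X1 R \<phi> lam \<mu> t;
          Qinv = inv_into X1 Q;
          E = E_op X2 L R \<mu>;
          Einv = inv_into X1 E;
          x = fst y;
          p = snd y
      in (- Qinv (P x) + Qinv (Einv p),
          - E (Q (x - Qinv (P (Qinv (P x))))) + (- E (P (Qinv (Einv p))))))"

end

theory Submission
  imports Defs
begin

text \<open>
  All operators involved are diagonal in the eigenbasis \<open>\<phi>\<close>. Write \<open>x\<^sub>n\<close> and \<open>p\<^sub>n\<close> for the
  coefficients of \<open>x\<close> and \<open>p\<close>, and give the \<open>n\<close>-th mode of \<open>(x, p)\<close> the coordinates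
  \<open>(sqrt \<lambda>\<^sub>n * x\<^sub>n, p\<^sub>n)\<close>. In these coordinates the energy norm on \<open>\<Y>\<close> is the Euclidean one, summed
  over the modes.

  The exact group rotates the \<open>n\<close>-th mode by the angle \<open>sqrt \<lambda>\<^sub>n * t\<close> (\<open>group_rotates\<close>): on the domain
  of the generator the coefficients solve the harmonic oscillator equation, and the general case follows
  by density and boundedness. The prototype rotates the same mode by \<open>\<omega>\<^sub>n * t\<close>, where \<open>\<omega>\<^sub>n\<close> is the
  frequency belonging to \<open>\<mu>\<close> (\<open>prototype_rotates\<close>): with the multipliers \<open>- cos / (\<omega>\<^sub>n sin)\<close> of \<open>P\<close>,
  \<open>1 / (\<omega>\<^sub>n sin)\<close> of \<open>Q\<close> and \<open>sqrt \<lambda>\<^sub>n * \<omega>\<^sub>n\<close> of \<open>E\<close>, the four blocks multiply out to the entries of a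
  rotation matrix. The admissibility of \<open>t\<close> enters here. It makes every \<open>sin (\<omega>\<^sub>n * t)\<close> nonzero, and it
  does the same for \<open>sin (t / \<mu>)\<close>; since \<open>\<omega>\<^sub>n\<close> tends to \<open>1 / \<mu>\<close> as \<open>n\<close> grows, the multipliers of \<open>P\<close>
  and \<open>Q\<close> are bounded.

  Two rotations by \<open>\<alpha>\<close> and \<open>\<beta>\<close> differ, on a vector of length \<open>r\<close>, by a vector of squared length
  \<open>(2 - 2 cos (\<alpha> - \<beta>)) r\<^sup>2\<close>. So the squared distance in question is a series that is dominated by four
  times the energy of \<open>(x, p)\<close> and each of whose terms tends to zero with \<open>\<mu>\<close>, because then
  \<open>\<omega>\<^sub>n\<close> tends to \<open>sqrt \<lambda>\<^sub>n\<close>. Tannery's theorem gives the claim (\<open>rotations_converge\<close>). The angles do not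
  converge uniformly in \<open>n\<close>, so the argument gives strong convergence rather than convergence in norm.
\<close>

section \<open>Bounded multipliers of square-summable sequences\<close>

lemma summable_square_mult:
  fixes a m :: "nat \<Rightarrow> real"
  assumes "summable (\<lambda>n. (a n)\<^sup>2)" and "Bseq m"
  shows "summable (\<lambda>n. (m n * a n)\<^sup>2)"
proof -
  obtain K where K: "\<And>n. \<bar>m n\<bar> \<le> K"
    using \<open>Bseq m\<close> by (auto simp: Bseq_def)
  show ?thesis
  proof (rule summable_comparison_test')
    show "summable (\<lambda>n. K\<^sup>2 * (a n)\<^sup>2)"
      using assms(1) by (rule summable_mult)
    show "norm ((m n * a n)\<^sup>2) \<le> K\<^sup>2 * (a n)\<^sup>2" if "n \<ge> 0" for n
    proof -
      have "(m n)\<^sup>2 \<le> K\<^sup>2"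
        using power_mono[OF K[of n], of 2] by simp
      then show ?thesis
        by (simp add: power_mult_distrib mult_right_mono)
    qed
  qed
qed

lemma Bseq_reciprocal:
  fixes X :: "nat \<Rightarrow> real"
  assumes "X \<longlonglongrightarrow> a" and "a \<noteq> 0"
  shows "Bseq (\<lambda>n. 1 / X n)"
  by (rule convergent_imp_Bseq[OF convergentI[OF tendsto_divide[OF tendsto_const assms]]])

section \<open>Square roots on eigenvectors\<close>

text \<open>
  The vector \<open>w = B v - sqrt a * v\<close> satisfies \<open>B w = - sqrt a * w\<close>, which positivity of \<open>B\<close> allows only
  for \<open>w = 0\<close>. This gives the action of any positive square root on an eigenbasis without a spectral
  theorem, and thereby also its uniqueness.
\<close>

lemma positive_sqrt_eigenvector:
  assumes sqrt: "is_positive_sqrt D A E B"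
    and v: "v \<in> D" "A v = a *\<^sub>R v" and "a > 0"
  shows "v \<in> E" and "B v = sqrt a *\<^sub>R v"
proof -
  have lin: "linear_op E B" and E: "v \<in> E" "B v \<in> E" "B (B v) = a *\<^sub>R v"
    using sqrt v by (auto simp: is_positive_sqrt_def self_adjoint_op_def)
  then show "v \<in> E"
    by simp
  define w where "w = B v + (- sqrt a) *\<^sub>R v"
  have "subspace E"
    using lin by (simp add: linear_op_def)
  from this have sE: "(- sqrt a) *\<^sub>R v \<in> E"
    using E(1) by (rule subspace_scale)
  then have "w \<in> E"
    using subspace_add[OF \<open>subspace E\<close> E(2) sE] by (simp add: w_def)
  have "B w = B (B v) + (- sqrt a) *\<^sub>R B v"
    using lin E sE unfolding w_def linear_op_def by metis
  also have "\<dots> = - (sqrt a *\<^sub>R w)"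
    using E \<open>a > 0\<close> by (simp add: w_def algebra_simps)
  finally have "B w \<bullet> w = - (sqrt a * (w \<bullet> w))"
    by simp
  moreover have "sqrt a * (w \<bullet> w) \<ge> 0"
    using \<open>a > 0\<close> by simp
  ultimately have "\<not> B w \<bullet> w > 0"
    by linarith
  then have "w = 0"
    using sqrt \<open>w \<in> E\<close> by (auto simp: is_positive_sqrt_def positive_op_def)
  then show "B v = sqrt a *\<^sub>R v"
    by (simp add: w_def)
qed

section \<open>Fourier series in a Hilbert space\<close>

locale hilbert_basis =
  fixes \<phi> :: "nat \<Rightarrow> 'a::{real_inner, complete_space}"
  assumes basis: "orthonormal_basis \<phi>"
begin

lemma inner_basis: "\<phi> m \<bullet> \<phi> n = (if m = n then 1 else 0)"
  using basis by (auto simp: orthonormal_basis_def)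

lemma norm_basis: "norm (\<phi> n) = 1"
  using inner_basis[of n n] by (simp add: norm_eq_sqrt_inner)

lemma inner_partial_sum: "(\<Sum>n<m. a n *\<^sub>R \<phi> n) \<bullet> \<phi> k = (if k < m then a k else 0)"
  by (simp add: inner_sum_left inner_basis if_distrib[of "\<lambda>x. _ * x"] cong: if_cong)

lemma norm_finite_sum:
  assumes "finite F"
  shows "(norm (\<Sum>n\<in>F. a n *\<^sub>R \<phi> n))\<^sup>2 = (\<Sum>n\<in>F. (a n)\<^sup>2)"
proof -
  have "pairwise (\<lambda>i j. orthogonal (a i *\<^sub>R \<phi> i) (a j *\<^sub>R \<phi> j)) F"
    by (auto simp: pairwise_def orthogonal_def inner_basis)
  then show ?thesis
    using norm_sum_Pythagorean[OF assms, of "\<lambda>n. a n *\<^sub>R \<phi> n"] by (simp add: norm_basis)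
qed

lemma bessel: "norm (\<Sum>n<m. (x \<bullet> \<phi> n) *\<^sub>R \<phi> n) \<le> norm x"
proof -
  let ?S = "\<Sum>n<m. (x \<bullet> \<phi> n) *\<^sub>R \<phi> n"
  have "(norm ?S)\<^sup>2 = x \<bullet> ?S"
    by (simp add: norm_finite_sum inner_sum_right flip: power2_eq_square)
  also have "\<dots> \<le> norm x * norm ?S"
    by (rule norm_cauchy_schwarz)
  finally show ?thesis
    by (cases "norm ?S = 0") (auto simp: power2_eq_square)
qed

text \<open>
  The vectors whose Fourier series converges to them form a subspace containing the basis. It is
  closed because, by Bessel's inequality, the partial sum operators do not increase the norm; so it is everything.
\<close>

lemma fourier_series: "(\<lambda>n. (x \<bullet> \<phi> n) *\<^sub>R \<phi> n) sums x"
proof -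
  define C where "C = {x. (\<lambda>n. (x \<bullet> \<phi> n) *\<^sub>R \<phi> n) sums x}"
  have "subspace C"
  proof (rule subspaceI)
    show "0 \<in> C"
      by (simp add: C_def)
    show "x + y \<in> C" if "x \<in> C" "y \<in> C" for x y
      using sums_add[of "\<lambda>n. (x \<bullet> \<phi> n) *\<^sub>R \<phi> n" x "\<lambda>n. (y \<bullet> \<phi> n) *\<^sub>R \<phi> n" y] that
      by (simp add: C_def inner_add_left scaleR_add_left)
    show "c *\<^sub>R x \<in> C" if "x \<in> C" for c x
      using bounded_linear.sums[OF bounded_linear_scaleR_right, of "\<lambda>n. (x \<bullet> \<phi> n) *\<^sub>R \<phi> n" x c] that
      by (simp add: C_def)
  qed
  moreover have "\<phi> k \<in> C" for k
    using sums_single[of k "\<lambda>n. \<phi> n"]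
    by (simp add: C_def inner_basis if_distrib[of "\<lambda>c. c *\<^sub>R _"] eq_commute cong: if_cong)
  ultimately have span: "span (range \<phi>) \<subseteq> C"
    by (intro span_minimal) auto
  have "\<exists>N. \<forall>m\<ge>N. norm ((\<Sum>n<m. (x \<bullet> \<phi> n) *\<^sub>R \<phi> n) - x) < e" if "e > 0" for e
  proof -
    have "x \<in> closure (span (range \<phi>))"
      using basis by (simp add: orthonormal_basis_def)
    then obtain y where y: "y \<in> span (range \<phi>)" "norm (y - x) < e / 3"
      using \<open>e > 0\<close> unfolding closure_approachable dist_norm
      by (meson divide_pos_pos zero_less_numeral)
    then have "(\<lambda>m. \<Sum>n<m. (y \<bullet> \<phi> n) *\<^sub>R \<phi> n) \<longlonglongrightarrow> y"
      using span by (auto simp: C_def sums_def)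
    from LIMSEQ_D[OF this, of "e / 3"]
    obtain N where N: "norm ((\<Sum>n<m. (y \<bullet> \<phi> n) *\<^sub>R \<phi> n) - y) < e / 3" if "m \<ge> N" for m
      using \<open>e > 0\<close> by auto
    have "norm ((\<Sum>n<m. (x \<bullet> \<phi> n) *\<^sub>R \<phi> n) - x) < e" if "m \<ge> N" for m
    proof -
      have "(\<Sum>n<m. (x \<bullet> \<phi> n) *\<^sub>R \<phi> n) - x = (\<Sum>n<m. ((x - y) \<bullet> \<phi> n) *\<^sub>R \<phi> n)
          + (((\<Sum>n<m. (y \<bullet> \<phi> n) *\<^sub>R \<phi> n) - y) + (y - x))"
        by (simp add: inner_diff_left scaleR_diff_left sum_subtractf)
      also have "norm \<dots> \<le> norm (x - y) + (norm ((\<Sum>n<m. (y \<bullet> \<phi> n) *\<^sub>R \<phi> n) - y) + norm (y - x))"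
        by (intro order_trans[OF norm_triangle_ineq] add_mono bessel) auto
      also have "\<dots> < e / 3 + (e / 3 + e / 3)"
        using y(2) N[OF that] by (auto simp: norm_minus_commute intro!: add_strict_mono)
      finally show ?thesis
        by simp
    qed
    then show ?thesis
      by blast
  qed
  then show ?thesis
    unfolding sums_def by (intro LIMSEQ_I) blast
qed

lemma parseval: "(\<lambda>n. (x \<bullet> \<phi> n) * (y \<bullet> \<phi> n)) sums (x \<bullet> y)"
proof -
  have "(\<lambda>n. y \<bullet> ((x \<bullet> \<phi> n) *\<^sub>R \<phi> n)) sums (y \<bullet> x)"
    by (rule bounded_linear.sums[OF bounded_linear_inner_right fourier_series])
  then show ?thesis
    by (simp add: inner_commute)
qed

lemma summable_coefficients: "summable (\<lambda>n. (x \<bullet> \<phi> n)\<^sup>2)"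
  using parseval[of x x] by (auto simp: power2_eq_square sums_iff)

lemma coefficients_eqI:
  assumes "\<And>n. x \<bullet> \<phi> n = y \<bullet> \<phi> n"
  shows "x = y"
  using fourier_series[of x] fourier_series[of y] assms by (auto dest: sums_unique2)

text \<open>
  By orthogonality the partial sums are Cauchy, and completeness of the space provides the limit. This is
  what makes multipliers act as operators.
\<close>

lemma riesz_fischer:
  assumes "summable (\<lambda>n. (a n)\<^sup>2)"
  obtains x where "\<And>n. x \<bullet> \<phi> n = a n"
proof -
  define s where "s m = (\<Sum>n<m. a n *\<^sub>R \<phi> n)" for m
  have "Cauchy s"
  proof (rule CauchyI')
    fix e :: real assume "e > 0"
    then have "e\<^sup>2 > 0"
      by simp
    then obtain N where N: "norm (sum (\<lambda>n. (a n)\<^sup>2) {m..<n}) < e\<^sup>2" if "m \<ge> N" for m n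
      using assms unfolding summable_Cauchy by blast
    have "dist (s m) (s n) < e" if "m \<ge> N" "n > m" for m n
    proof -
      have "s n - s m = (\<Sum>k\<in>{m..<n}. a k *\<^sub>R \<phi> k)"
        using sum_diff_nat_ivl[of 0 m n "\<lambda>k. a k *\<^sub>R \<phi> k"] that
        by (simp add: s_def lessThan_atLeast0)
      then have "(norm (s n - s m))\<^sup>2 < e\<^sup>2"
        using N[OF that(1), of n] by (simp add: norm_finite_sum)
      then show ?thesis
        using \<open>e > 0\<close> by (simp add: dist_norm norm_minus_commute power_less_imp_less_base)
    qed
    then show "\<exists>M. \<forall>m\<ge>M. \<forall>n>m. dist (s m) (s n) < e"
      by blast
  qed
  then obtain x where "s \<longlonglongrightarrow> x"
    using Cauchy_convergent convergent_def by blast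
  have "x \<bullet> \<phi> n = a n" for n
  proof (rule LIMSEQ_unique)
    show "(\<lambda>m. s m \<bullet> \<phi> n) \<longlonglongrightarrow> x \<bullet> \<phi> n"
      by (intro tendsto_intros \<open>s \<longlonglongrightarrow> x\<close>)
    show "(\<lambda>m. s m \<bullet> \<phi> n) \<longlonglongrightarrow> a n"
      by (intro tendsto_eventually eventually_sequentiallyI[of "Suc n"])
        (auto simp: s_def inner_partial_sum)
  qed
  then show thesis
    by (rule that)
qed

lemma bounded_multiplier:
  assumes "Bseq m"
  obtains y where "\<And>n. y \<bullet> \<phi> n = m n * (x \<bullet> \<phi> n)"
  using summable_square_mult[OF summable_coefficients assms] by (rule riesz_fischer) (rule that)

section \<open>Operators that are diagonal in a Hilbert basis\<close>

lemma self_adjoint_coefficient: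
  assumes "self_adjoint_op D A" "\<phi> n \<in> D" "A (\<phi> n) = d n *\<^sub>R \<phi> n" "y \<in> D"
  shows "A y \<bullet> \<phi> n = d n * (y \<bullet> \<phi> n)"
  using assms unfolding self_adjoint_op_def by (metis inner_scaleR_right)

text \<open>
  Maximality of the domain is what self-adjointness adds to symmetry: if the coefficients
  \<open>d n * (y \<bullet> \<phi> n)\<close> are square summable, the vector that they define is a value of the adjoint at \<open>y\<close>, so
  \<open>y\<close> lies in the domain.
\<close>

lemma self_adjoint_domain:
  assumes A: "self_adjoint_op D A" and eigen: "\<And>n. \<phi> n \<in> D \<and> A (\<phi> n) = d n *\<^sub>R \<phi> n"
  shows "y \<in> D \<longleftrightarrow> summable (\<lambda>n. (d n * (y \<bullet> \<phi> n))\<^sup>2)"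
proof
  assume "y \<in> D"
  then show "summable (\<lambda>n. (d n * (y \<bullet> \<phi> n))\<^sup>2)"
    using summable_coefficients[of "A y"] self_adjoint_coefficient[where d = d, OF A] eigen by simp
next
  assume "summable (\<lambda>n. (d n * (y \<bullet> \<phi> n))\<^sup>2)"
  then obtain z where z: "\<And>n. z \<bullet> \<phi> n = d n * (y \<bullet> \<phi> n)"
    by (rule riesz_fischer) (rule that)
  have "A x \<bullet> y = x \<bullet> z" if "x \<in> D" for x
    using parseval[of "A x" y] parseval[of x z] self_adjoint_coefficient[where d = d, OF A _ _ that] eigen z
    by (simp add: mult_ac sums_iff)
  then show "y \<in> D"
    using A unfolding self_adjoint_op_def by blast
qed

lemma diagonal_self_adjoint:
  assumes B: "\<And>x n. B x \<bullet> \<phi> n = b n * (x \<bullet> \<phi> n)"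
  shows "self_adjoint_op UNIV B"
proof -
  have "B x \<bullet> y = x \<bullet> B y" for x y
    using parseval[of "B x" y] parseval[of x "B y"] by (simp add: B mult_ac sums_iff)
  then have "(\<forall>x. B x \<bullet> y = x \<bullet> z) \<longleftrightarrow> z = B y" for y z
    by (metis vector_eq_ldot)
  moreover have "B (x + y) = B x + B y" "B (c *\<^sub>R x) = c *\<^sub>R B x" for x y c
    by (auto intro!: coefficients_eqI simp: B inner_add_left algebra_simps)
  ultimately show ?thesis
    by (simp add: self_adjoint_op_def linear_op_def)
qed

text \<open>
  The domain and the codomain matter because the operators of the prototype are total functions whose
  values are meaningful only on \<open>X1\<close> or \<open>X2\<close>.
\<close>

definition diagonal_on :: "'a set \<Rightarrow> 'a set \<Rightarrow> ('a \<Rightarrow> 'a) \<Rightarrow> (nat \<Rightarrow> real) \<Rightarrow> bool" where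
  "diagonal_on V W T m \<longleftrightarrow> (\<forall>x\<in>V. T x \<in> W \<and> (\<forall>n. T x \<bullet> \<phi> n = m n * (x \<bullet> \<phi> n)))"

text \<open>
  The hypothesis \<open>surj\<close> is where boundedness of the inverse multiplier comes in for the operators
  below; injectivity already follows from the nonzero multipliers.
\<close>

lemma diagonal_on_inv_into:
  assumes T: "diagonal_on V W T m"
    and nonzero: "\<And>n. m n \<noteq> 0"
    and surj: "\<And>y. y \<in> W \<Longrightarrow> \<exists>x\<in>V. \<forall>n. x \<bullet> \<phi> n = (y \<bullet> \<phi> n) / m n"
  shows "diagonal_on W V (inv_into V T) (\<lambda>n. 1 / m n)"
  unfolding diagonal_on_def
proof
  fix y assume "y \<in> W"
  then obtain x where x: "x \<in> V" "\<And>n. x \<bullet> \<phi> n = (y \<bullet> \<phi> n) / m n"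
    using surj by blast
  have "T x = y"
    using T x nonzero by (intro coefficients_eqI) (simp add: diagonal_on_def)
  moreover have "inj_on T V"
  proof (intro inj_onI coefficients_eqI)
    fix x y n assume "x \<in> V" "y \<in> V" "T x = T y"
    then have "m n * (x \<bullet> \<phi> n) = m n * (y \<bullet> \<phi> n)"
      using T by (metis diagonal_on_def)
    then show "x \<bullet> \<phi> n = y \<bullet> \<phi> n"
      using nonzero by simp
  qed
  ultimately have "inv_into V T y = x"
    using x(1) by (intro inv_into_f_eq)
  with x show "inv_into V T y \<in> V \<and> (\<forall>n. inv_into V T y \<bullet> \<phi> n = 1 / m n * (y \<bullet> \<phi> n))"
    by simp
qed

end

section \<open>Strongly continuous groups and the harmonic oscillator\<close>

lemma linear_op_diff:
  assumes "linear_op D A" and "a \<in> D" and "b \<in> D"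
  shows "A (a - b) = A a - A b"
proof -
  note lin = assms(1)[unfolded linear_op_def]
  have "A (- 1 *\<^sub>R b) = - 1 *\<^sub>R A b"
    using lin assms(3) by blast
  moreover have "- 1 *\<^sub>R b \<in> D"
    using lin assms(3) subspace_scale by blast
  then have "A (a + - 1 *\<^sub>R b) = A a + A (- 1 *\<^sub>R b)"
    using lin assms(2) by blast
  ultimately show ?thesis
    by simp
qed

lemma
  assumes "C0_group V N U"
  shows C0_group_linear: "linear_op V (U t)"
    and C0_group_closed: "v \<in> V \<Longrightarrow> U t v \<in> V"
    and C0_group_bounded: "\<exists>K. \<forall>v\<in>V. N (U t v) \<le> K * N v"
    and C0_group_zero: "v \<in> V \<Longrightarrow> U 0 v = v"
    and C0_group_add: "v \<in> V \<Longrightarrow> U (s + t) v = U s (U t v)"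
proof -
  note group = assms[unfolded C0_group_def]
  show "linear_op V (U t)"
    by (rule group[THEN conjunct1, THEN spec, THEN conjunct1])
  show "U t v \<in> V" if "v \<in> V"
    using group[THEN conjunct1, THEN spec[of _ t], THEN conjunct2, THEN conjunct1] that by auto
  show "\<exists>K. \<forall>v\<in>V. N (U t v) \<le> K * N v"
    by (rule group[THEN conjunct1, THEN spec, THEN conjunct2, THEN conjunct2])
  show "U 0 v = v" if "v \<in> V"
    by (rule group[THEN conjunct2, THEN conjunct1, THEN bspec, OF that])
  show "U (s + t) v = U s (U t v)" if "v \<in> V"
    by (rule group[THEN conjunct2, THEN conjunct2, THEN conjunct1, THEN spec, THEN spec, THEN bspec, OF that])
qed

lemma
  assumes "generated_by V N U D A"
  shows generated_by_domain: "v \<in> D \<Longrightarrow> v \<in> V" "v \<in> D \<Longrightarrow> A v \<in> V"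
    and generated_by_iff: "v \<in> V \<Longrightarrow> z \<in> V \<Longrightarrow>
      ((\<lambda>h. N ((1 / h) *\<^sub>R (U h v - v) - z)) \<longlongrightarrow> 0) (at 0) \<longleftrightarrow> v \<in> D \<and> z = A v"
proof -
  note gen = assms[unfolded generated_by_def]
  show "v \<in> V" if "v \<in> D"
    using gen[THEN conjunct1] that by auto
  show "A v \<in> V" if "v \<in> D"
    using gen[THEN conjunct2, THEN conjunct1] that by auto
  show "((\<lambda>h. N ((1 / h) *\<^sub>R (U h v - v) - z)) \<longlongrightarrow> 0) (at 0) \<longleftrightarrow> v \<in> D \<and> z = A v"
    if "v \<in> V" "z \<in> V"
    by (rule gen[THEN conjunct2, THEN conjunct2, THEN bspec, THEN bspec, OF that])
qed

text \<open>
  The difference quotient at \<open>U s v\<close> is the image under \<open>U s\<close> of the one at \<open>v\<close>, because the group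
  commutes, and \<open>U s\<close> is bounded. Hence orbits that start in the domain are differentiable at all
  times.
\<close>

lemma generator_domain_invariant:
  assumes V: "subspace V"
    and group: "C0_group V N U"
    and gen: "generated_by V N U D A"
    and pos: "\<And>v. v \<in> V \<Longrightarrow> N v \<ge> 0"
    and v: "v \<in> D"
  shows "U s v \<in> D"
proof -
  note in_V = generated_by_domain[OF gen v]
  note closed = C0_group_closed[OF group]
  note lin = C0_group_linear[OF group]
  obtain K where K: "\<And>w. w \<in> V \<Longrightarrow> N (U s w) \<le> K * N w"
    using C0_group_bounded[OF group, of s] by auto
  let ?d = "\<lambda>h. U h v - v" and ?q = "\<lambda>h. (1 / h) *\<^sub>R (U h v - v)"
  have d: "?d h \<in> V" for h
    by (intro subspace_diff V closed in_V)
  have q: "?q h \<in> V" for h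
    by (intro subspace_scale V d)
  have q': "?q h - A v \<in> V" for h
    by (intro subspace_diff V q in_V)
  have eq: "(1 / h) *\<^sub>R (U h (U s v) - U s v) - U s (A v) = U s (?q h - A v)" for h
  proof -
    have "U h (U s v) = U s (U h v)"
      using C0_group_add[OF group in_V(1), of h s] C0_group_add[OF group in_V(1), of s h]
      by (simp add: add.commute)
    then have "U h (U s v) - U s v = U s (?d h)"
      by (simp add: linear_op_diff[OF lin closed[OF in_V(1)] in_V(1)])
    moreover have "U s (?q h) = (1 / h) *\<^sub>R U s (?d h)"
      using lin[of s, unfolded linear_op_def, THEN conjunct2, THEN conjunct2] d by blast
    ultimately show ?thesis
      by (simp add: linear_op_diff[OF lin q in_V(2)])
  qed
  have "((\<lambda>h. N (?q h - A v)) \<longlongrightarrow> 0) (at 0)"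
    using v by (simp add: generated_by_iff[OF gen in_V])
  then have "((\<lambda>h. K * N (?q h - A v)) \<longlongrightarrow> 0) (at 0)"
    by (rule tendsto_mult_right_zero)
  then have "((\<lambda>h. N (U s (?q h - A v))) \<longlongrightarrow> 0) (at 0)"
    by (rule Lim_null_comparison[rotated]) (simp add: K[OF q'] pos[OF closed[OF q']])
  then have "((\<lambda>h. N ((1 / h) *\<^sub>R (U h (U s v) - U s v) - U s (A v))) \<longlongrightarrow> 0) (at 0)"
    unfolding eq .
  then show "U s v \<in> D"
    by (simp only: generated_by_iff[OF gen closed[OF in_V(1)] closed[OF in_V(2)]])
qed

text \<open>
  Undoing the expected rotation turns the solution into a pair of constants.
\<close>

lemma harmonic_oscillator:
  fixes a b :: "real \<Rightarrow> real"
  assumes "w \<noteq> 0"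
    and a: "\<And>s. (a has_real_derivative b s) (at s)"
    and b: "\<And>s. (b has_real_derivative - (w\<^sup>2 * a s)) (at s)"
  shows "a s = cos (w * s) * a 0 + sin (w * s) / w * b 0"
    and "b s = - w * sin (w * s) * a 0 + cos (w * s) * b 0"
proof -
  let ?f = "\<lambda>s. w * cos (w * s) * a s - sin (w * s) * b s"
  let ?g = "\<lambda>s. w * sin (w * s) * a s + cos (w * s) * b s"
  have "(?f has_real_derivative 0) (at s)" "(?g has_real_derivative 0) (at s)" for s
    by (auto intro!: derivative_eq_intros a b simp: algebra_simps power2_eq_square)
  then have f: "?f s = w * a 0" and g: "?g s = b 0"
    using DERIV_isconst_all[of ?f s 0] DERIV_isconst_all[of ?g s 0] by auto
  have "cos (w * s) * ?f s + sin (w * s) * ?g s = w * a s * ((sin (w * s))\<^sup>2 + (cos (w * s))\<^sup>2)"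
    by algebra
  then have "w * a s = cos (w * s) * ?f s + sin (w * s) * ?g s"
    by simp
  then show "a s = cos (w * s) * a 0 + sin (w * s) / w * b 0"
    unfolding f g using \<open>w \<noteq> 0\<close> by (simp add: field_simps)
  have "- sin (w * s) * ?f s + cos (w * s) * ?g s = b s * ((sin (w * s))\<^sup>2 + (cos (w * s))\<^sup>2)"
    by algebra
  then have "b s = - sin (w * s) * ?f s + cos (w * s) * ?g s"
    by simp
  then show "b s = - w * sin (w * s) * a 0 + cos (w * s) * b 0"
    unfolding f g by simp
qed

section \<open>The energy space in coordinates\<close>

text \<open>
  The data of the theorem that do not depend on \<open>\<mu>\<close>, \<open>t\<close> or the group.
\<close>

locale wave_system = hilbert_basis \<phi>
  for \<phi> :: "nat \<Rightarrow> 'a::{real_inner, complete_space}" +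
  fixes X2 :: "'a set" and L :: "'a \<Rightarrow> 'a" and X1 :: "'a set" and R :: "'a \<Rightarrow> 'a"
    and lam :: "nat \<Rightarrow> real"
  assumes L_self_adjoint: "self_adjoint_op X2 L"
    and R_sqrt: "is_positive_sqrt X2 L X1 R"
    and eigen: "\<And>n. \<phi> n \<in> X2 \<and> L (\<phi> n) = lam n *\<^sub>R \<phi> n"
    and lam_pos: "\<And>n. lam n > 0"
    and lam_at_top: "filterlim lam at_top sequentially"
begin

lemma R_self_adjoint: "self_adjoint_op X1 R"
  using R_sqrt by (simp add: is_positive_sqrt_def)

lemma X2_subset_X1: "X2 \<subseteq> X1"
  using R_sqrt by (auto simp: is_positive_sqrt_def)

lemma subspace_X1: "subspace X1"
  using R_self_adjoint by (simp add: self_adjoint_op_def linear_op_def)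

lemma subspace_X2: "subspace X2"
  using L_self_adjoint by (simp add: self_adjoint_op_def linear_op_def)

lemma eigen_R: "\<phi> n \<in> X1 \<and> R (\<phi> n) = sqrt (lam n) *\<^sub>R \<phi> n"
  using positive_sqrt_eigenvector[OF R_sqrt conjunct1[OF eigen] conjunct2[OF eigen] lam_pos]
  by (rule conjI)

lemma L_coefficient: "y \<in> X2 \<Longrightarrow> L y \<bullet> \<phi> n = lam n * (y \<bullet> \<phi> n)"
  by (rule self_adjoint_coefficient[OF L_self_adjoint conjunct1[OF eigen] conjunct2[OF eigen]])

lemma R_coefficient: "y \<in> X1 \<Longrightarrow> R y \<bullet> \<phi> n = sqrt (lam n) * (y \<bullet> \<phi> n)"
  by (rule self_adjoint_coefficient[OF R_self_adjoint conjunct1[OF eigen_R] conjunct2[OF eigen_R]])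

lemma X1_iff: "y \<in> X1 \<longleftrightarrow> summable (\<lambda>n. (sqrt (lam n) * (y \<bullet> \<phi> n))\<^sup>2)"
  by (rule self_adjoint_domain[OF R_self_adjoint eigen_R])

lemma X2_iff: "y \<in> X2 \<longleftrightarrow> summable (\<lambda>n. (lam n * (y \<bullet> \<phi> n))\<^sup>2)"
  by (rule self_adjoint_domain[OF L_self_adjoint eigen])

lemma R_diff: "x \<in> X1 \<Longrightarrow> y \<in> X1 \<Longrightarrow> R (x - y) = R x - R y"
  by (rule coefficients_eqI)
    (simp add: R_coefficient subspace_diff[OF subspace_X1] inner_diff_left algebra_simps)

lemma partial_sum_in_X2: "(\<Sum>n<m. a n *\<^sub>R \<phi> n) \<in> X2"
  using eigen by (intro subspace_sum subspace_scale subspace_X2) blast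

lemma partial_sum_in_X1: "(\<Sum>n<m. a n *\<^sub>R \<phi> n) \<in> X1"
  by (rule subsetD[OF X2_subset_X1 partial_sum_in_X2])

lemma R_partial_sum:
  assumes "x \<in> X1"
  shows "R (\<Sum>n<m. (x \<bullet> \<phi> n) *\<^sub>R \<phi> n) = (\<Sum>n<m. (R x \<bullet> \<phi> n) *\<^sub>R \<phi> n)"
  using assms by (intro coefficients_eqI) (simp add: R_coefficient partial_sum_in_X1 inner_partial_sum)

lemma norm1_eq: "norm1 R x = norm (R x)"
  by (simp add: norm1_def inner1_def norm_eq_sqrt_inner)

lemma partial_sums_norm1:
  assumes "x \<in> X1"
  shows "(\<lambda>m. norm1 R ((\<Sum>n<m. (x \<bullet> \<phi> n) *\<^sub>R \<phi> n) - x)) \<longlonglongrightarrow> 0"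
proof -
  have "(\<lambda>m. norm ((\<Sum>n<m. (R x \<bullet> \<phi> n) *\<^sub>R \<phi> n) - R x)) \<longlonglongrightarrow> 0"
    using fourier_series[of "R x"] unfolding sums_def
    by (rule tendsto_norm_zero[OF LIM_zero])
  then show ?thesis
    using assms by (simp add: norm1_eq R_diff R_partial_sum partial_sum_in_X1)
qed

text \<open>
  The description of the sum in \<open>series_on\<close> determines it uniquely, since \<open>R\<close> turns the norm of \<open>X1\<close> into
  the ambient norm and is injective.
\<close>

lemma series_on_X1:
  assumes "x \<in> X1"
  shows "series_on X1 (norm1 R) (\<lambda>n. (x \<bullet> \<phi> n) *\<^sub>R \<phi> n) = x"
  unfolding series_on_def
proof (rule the_equality)
  show "x \<in> X1 \<and> (\<lambda>m. norm1 R ((\<Sum>n<m. (x \<bullet> \<phi> n) *\<^sub>R \<phi> n) - x)) \<longlonglongrightarrow> 0"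
    using assms partial_sums_norm1 by blast
  let ?s = "\<lambda>m. \<Sum>n<m. (x \<bullet> \<phi> n) *\<^sub>R \<phi> n"
  have s: "?s m \<in> X1" for m
    by (rule partial_sum_in_X1)
  have lim: "(\<lambda>m. R (?s m)) \<longlonglongrightarrow> R y" if "y \<in> X1" "(\<lambda>m. norm1 R (?s m - y)) \<longlonglongrightarrow> 0" for y
    using that s by (subst LIM_zero_iff[symmetric]) (simp add: norm1_eq R_diff tendsto_norm_zero_iff)
  fix y assume y: "y \<in> X1 \<and> (\<lambda>m. norm1 R (?s m - y)) \<longlonglongrightarrow> 0"
  have "R y = R x"
    using lim[of y] lim[of x] y assms partial_sums_norm1 LIMSEQ_unique by blast
  have "sqrt (lam n) * (y \<bullet> \<phi> n) = sqrt (lam n) * (x \<bullet> \<phi> n)" for n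
    using R_coefficient y assms \<open>R y = R x\<close> by metis
  then show "y = x"
    using lam_pos by (intro coefficients_eqI) (simp add: less_imp_neq[symmetric])
qed

lemma multiplier_in_X1:
  assumes "x \<in> X1" and "Bseq m"
  obtains y where "y \<in> X1" "\<And>n. y \<bullet> \<phi> n = m n * (x \<bullet> \<phi> n)"
proof -
  obtain y where y: "\<And>n. y \<bullet> \<phi> n = m n * (x \<bullet> \<phi> n)"
    using \<open>Bseq m\<close> by (rule bounded_multiplier) (rule that)
  have "summable (\<lambda>n. (m n * (sqrt (lam n) * (x \<bullet> \<phi> n)))\<^sup>2)"
    using \<open>x \<in> X1\<close> \<open>Bseq m\<close> by (intro summable_square_mult[of _ m]) (simp_all add: X1_iff)
  then have "y \<in> X1"
    by (simp add: X1_iff y mult_ac)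
  then show thesis
    using that y by blast
qed

text \<open>
  As \<open>R\<close> maps the normalised eigenvectors of \<open>X1\<close> to \<open>\<phi>\<close>, the factors \<open>sqrt (lam n)\<close> of
  \<open>inner1 R \<xi> (phi1 \<phi> lam n)\<close> and \<open>phi1 \<phi> lam n\<close> cancel, and the series is a Fourier series in disguise.
\<close>

lemma diagonal_series:
  assumes "Bseq m"
  shows "diagonal_on X1 X1
    (\<lambda>\<xi>. series_on X1 (norm1 R) (\<lambda>n. (m n * inner1 R \<xi> (phi1 \<phi> lam n)) *\<^sub>R phi1 \<phi> lam n)) m"
  unfolding diagonal_on_def
proof
  fix \<xi> assume \<xi>: "\<xi> \<in> X1"
  obtain y where y: "y \<in> X1" "\<And>n. y \<bullet> \<phi> n = m n * (\<xi> \<bullet> \<phi> n)"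
    using multiplier_in_X1[OF \<xi> assms] by blast
  have "R (phi1 \<phi> lam n) = \<phi> n" for n
  proof -
    have "R (phi1 \<phi> lam n) = (1 / sqrt (lam n)) *\<^sub>R R (\<phi> n)"
      using R_self_adjoint eigen_R unfolding self_adjoint_op_def linear_op_def phi1_def by blast
    then show ?thesis
      using eigen_R lam_pos[of n] by simp
  qed
  then have "(m n * inner1 R \<xi> (phi1 \<phi> lam n)) *\<^sub>R phi1 \<phi> lam n = (y \<bullet> \<phi> n) *\<^sub>R \<phi> n" for n
    using lam_pos[of n] R_coefficient[OF \<xi>] y by (simp add: inner1_def phi1_def)
  then show "series_on X1 (norm1 R) (\<lambda>n. (m n * inner1 R \<xi> (phi1 \<phi> lam n)) *\<^sub>R phi1 \<phi> lam n) \<in> X1 \<and>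
    (\<forall>n. series_on X1 (norm1 R) (\<lambda>n. (m n * inner1 R \<xi> (phi1 \<phi> lam n)) *\<^sub>R phi1 \<phi> lam n) \<bullet> \<phi> n
      = m n * (\<xi> \<bullet> \<phi> n))"
    using series_on_X1[OF y(1)] y by simp
qed

section \<open>The frequencies\<close>

lemma freq_pos: "freq lam \<mu> n > 0"
  using lam_pos[of n] by (auto simp: freq_def intro!: divide_pos_pos add_pos_nonneg)

text \<open>
  For fixed positive \<open>\<mu>\<close> the frequencies accumulate only at \<open>1 / \<mu>\<close>. This is why excluding the critical
  times with \<open>n = \<infinity>\<close> as well as those of the single modes keeps the sines away from zero uniformly in \<open>n\<close>.
\<close>

lemma freq_limit:
  assumes "\<mu> > 0"
  shows "freq lam \<mu> \<longlonglongrightarrow> 1 / \<mu>"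
proof -
  have "((\<lambda>x::real. sqrt (1 / (inverse x + \<mu>\<^sup>2))) \<longlongrightarrow> sqrt (1 / (0 + \<mu>\<^sup>2))) at_top"
    using assms by (intro tendsto_intros tendsto_inverse_0_at_top filterlim_ident) auto
  from filterlim_compose[OF this lam_at_top]
  have "(\<lambda>n. sqrt (1 / (inverse (lam n) + \<mu>\<^sup>2))) \<longlonglongrightarrow> 1 / \<mu>"
    using assms by (simp add: real_sqrt_divide)
  moreover have "sqrt (1 / (inverse (lam n) + \<mu>\<^sup>2)) = freq lam \<mu> n" for n
    using lam_pos[of n] by (simp add: freq_def field_simps)
  ultimately show ?thesis
    by (simp add: fun_eq_iff)
qed

lemma freq_tendsto_sqrt:
  assumes "\<mu> \<longlonglongrightarrow> 0"
  shows "(\<lambda>i. freq lam (\<mu> i) n) \<longlonglongrightarrow> sqrt (lam n)"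
proof -
  have "(\<lambda>i. freq lam (\<mu> i) n) \<longlonglongrightarrow> sqrt (lam n / (1 + 0\<^sup>2 * lam n))"
    unfolding freq_def by (intro tendsto_intros assms) auto
  then show ?thesis
    by simp
qed

lemma Bseq_freq: "\<mu> > 0 \<Longrightarrow> Bseq (freq lam \<mu>)"
  using freq_limit convergentI convergent_imp_Bseq by blast

lemma Bseq_inverse_freq: "\<mu> > 0 \<Longrightarrow> Bseq (\<lambda>n. 1 / freq lam \<mu> n)"
  by (rule Bseq_reciprocal[OF freq_limit]) auto

lemma sin_nonzero:
  assumes "t \<in> Omega lam \<mu>"
  shows "sin (freq lam \<mu> n * t) \<noteq> 0" and "\<mu> > 0 \<Longrightarrow> sin (t / \<mu>) \<noteq> 0"
proof -
  have crit: "t \<noteq> crit_time lam \<mu> m j k" if "j \<ge> 1" "k \<ge> 1" for m j k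
    using assms that by (auto simp: Omega_def)
  have "t > 0"
    using assms by (simp add: Omega_def)
  \<comment> \<open>A positive zero of the sine is critical with \<open>k = 1\<close> and \<open>j\<close> even.\<close>
  have even_multiple: "\<exists>j\<ge>1. s = real j / real 1 * (pi / 2)" if "sin s = 0" "s > 0" for s :: real
  proof -
    obtain i :: int where i: "s = of_int i * pi"
      using \<open>sin s = 0\<close> by (auto simp: sin_zero_iff_int2)
    then have "i > 0"
      using \<open>s > 0\<close> by (simp add: zero_less_mult_iff)
    with i have "nat (2 * i) \<ge> 1" "s = real (nat (2 * i)) / real 1 * (pi / 2)"
      by auto
    then show ?thesis
      by blast
  qed
  show "sin (freq lam \<mu> n * t) \<noteq> 0"
  proof
    assume "sin (freq lam \<mu> n * t) = 0"
    then obtain j where "j \<ge> 1" "freq lam \<mu> n * t = real j / real 1 * (pi / 2)"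
      using even_multiple freq_pos[of \<mu> n] \<open>t > 0\<close> by (meson mult_pos_pos)
    then show False
      using crit[of j 1 "enat n"] freq_pos[of \<mu> n] by (simp add: crit_time_def field_simps)
  qed
  show "sin (t / \<mu>) \<noteq> 0" if "\<mu> > 0"
  proof
    assume "sin (t / \<mu>) = 0"
    then obtain j where "j \<ge> 1" "t / \<mu> = real j / real 1 * (pi / 2)"
      using even_multiple \<open>\<mu> > 0\<close> \<open>t > 0\<close> by (meson divide_pos_pos)
    then show False
      using crit[of j 1 \<infinity>] \<open>\<mu> > 0\<close> by (simp add: crit_time_def field_simps)
  qed
qed

lemma freq_sin_limit:
  assumes "\<mu> > 0"
  shows "(\<lambda>n. freq lam \<mu> n * sin (freq lam \<mu> n * t)) \<longlonglongrightarrow> 1 / \<mu> * sin (1 / \<mu> * t)"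
  using freq_limit[OF assms] by (intro tendsto_intros)

lemma Bseq_freq_sin: "\<mu> > 0 \<Longrightarrow> Bseq (\<lambda>n. freq lam \<mu> n * sin (freq lam \<mu> n * t))"
  by (rule convergent_imp_Bseq[OF convergentI[OF freq_sin_limit]])

lemma Bseq_inverse_freq_sin:
  assumes "\<mu> > 0" and "t \<in> Omega lam \<mu>"
  shows "Bseq (\<lambda>n. 1 / (freq lam \<mu> n * sin (freq lam \<mu> n * t)))"
  using sin_nonzero(2)[of t \<mu>] assms by (intro Bseq_reciprocal[OF freq_sin_limit]) auto

section \<open>The prototype in coordinates\<close>

text \<open>
  Surjectivity of \<open>I + \<mu>\<^sup>2 L\<close> holds because the candidate preimage lies in \<open>X2\<close>: its image under \<open>L\<close>
  would have the multiplier \<open>lam n / (1 + \<mu>\<^sup>2 * lam n)\<close>, the square of the bounded frequency.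
\<close>

lemma I_op_coefficient:
  assumes "\<mu> > 0"
  shows "I_op X2 L \<mu> x \<bullet> \<phi> n = 1 / (1 + \<mu>\<^sup>2 * lam n) * (x \<bullet> \<phi> n)"
proof -
  have pos: "1 + \<mu>\<^sup>2 * lam n > 0" for n
    using lam_pos[of n] by (intro add_pos_nonneg) auto
  have "diagonal_on UNIV X2 (inv_into X2 (\<lambda>x. x + \<mu>\<^sup>2 *\<^sub>R L x)) (\<lambda>n. 1 / (1 + \<mu>\<^sup>2 * lam n))"
  proof (rule diagonal_on_inv_into)
    show "diagonal_on X2 UNIV (\<lambda>x. x + \<mu>\<^sup>2 *\<^sub>R L x) (\<lambda>n. 1 + \<mu>\<^sup>2 * lam n)"
      by (simp add: diagonal_on_def inner_add_left L_coefficient algebra_simps)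
    show "1 + \<mu>\<^sup>2 * lam n \<noteq> 0" for n
      using pos[of n] by simp
    fix y :: 'a
    show "\<exists>x\<in>X2. \<forall>n. x \<bullet> \<phi> n = y \<bullet> \<phi> n / (1 + \<mu>\<^sup>2 * lam n)"
    proof -
      have "Bseq (\<lambda>n. 1 / (1 + \<mu>\<^sup>2 * lam n))"
        using pos lam_pos by (intro BseqI'[of _ 1]) (simp add: less_imp_le)
      then obtain x where x: "\<And>n. x \<bullet> \<phi> n = 1 / (1 + \<mu>\<^sup>2 * lam n) * (y \<bullet> \<phi> n)"
        by (rule bounded_multiplier) (rule that)
      have "lam n * (x \<bullet> \<phi> n) = (freq lam \<mu> n * freq lam \<mu> n) * (y \<bullet> \<phi> n)" for n
        using pos[of n] lam_pos[of n] by (simp add: x freq_def)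
      moreover have "summable (\<lambda>n. (freq lam \<mu> n * freq lam \<mu> n * (y \<bullet> \<phi> n))\<^sup>2)"
        using \<open>\<mu> > 0\<close> by (intro summable_square_mult[OF summable_coefficients] Bseq_mult Bseq_freq)
      ultimately have "x \<in> X2"
        by (simp add: X2_iff)
      with x show ?thesis
        by auto
    qed
  qed
  then show ?thesis
    by (simp add: diagonal_on_def I_op_def)
qed

lemma Bseq_I_multiplier: "Bseq (\<lambda>n. 1 / sqrt (1 + \<mu>\<^sup>2 * lam n))"
proof (rule BseqI')
  fix n
  have "1 \<le> sqrt (1 + \<mu>\<^sup>2 * lam n)"
    using lam_pos[of n] by (simp add: less_imp_le)
  then show "norm (1 / sqrt (1 + \<mu>\<^sup>2 * lam n)) \<le> 1"
    by simp
qed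

text \<open>
  The operator with these coefficients is a positive square root of \<open>I_op X2 L \<mu>\<close>. It is the only one, as
  any other has the same eigenvalues on \<open>\<phi>\<close>; so the definite description in \<open>I_half\<close> denotes it.
\<close>

lemma I_half_coefficient:
  assumes "\<mu> > 0"
  shows "I_half X2 L \<mu> x \<bullet> \<phi> n = 1 / sqrt (1 + \<mu>\<^sup>2 * lam n) * (x \<bullet> \<phi> n)"
proof -
  have pos: "1 + \<mu>\<^sup>2 * lam n > 0" for n
    using lam_pos[of n] by (intro add_pos_nonneg) auto
  have "\<forall>x. \<exists>y. \<forall>n. y \<bullet> \<phi> n = 1 / sqrt (1 + \<mu>\<^sup>2 * lam n) * (x \<bullet> \<phi> n)"
    using bounded_multiplier[OF Bseq_I_multiplier] by metis
  then obtain B where B: "\<And>x n. B x \<bullet> \<phi> n = 1 / sqrt (1 + \<mu>\<^sup>2 * lam n) * (x \<bullet> \<phi> n)"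
    by metis
  have "is_positive_sqrt UNIV (I_op X2 L \<mu>) UNIV B"
    unfolding is_positive_sqrt_def
  proof (intro conjI ballI)
    show "self_adjoint_op UNIV B"
      by (rule diagonal_self_adjoint[OF B])
    show "positive_op UNIV B"
      unfolding positive_op_def
    proof (intro ballI impI)
      fix x :: 'a assume "x \<noteq> 0"
      then obtain k where k: "x \<bullet> \<phi> k \<noteq> 0"
        using coefficients_eqI[of x 0] by auto
      let ?f = "\<lambda>n. (B x \<bullet> \<phi> n) * (x \<bullet> \<phi> n)"
      have "?f n = (x \<bullet> \<phi> n)\<^sup>2 / sqrt (1 + \<mu>\<^sup>2 * lam n)" for n
        by (simp add: B power2_eq_square)
      then have "?f n \<ge> 0" "?f k > 0" for n
        using k pos[of n] pos[of k] by auto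
      then have "suminf ?f > 0"
        using parseval[of "B x" x] by (intro suminf_pos2) (auto simp: sums_iff)
      then show "B x \<bullet> x > 0"
        using parseval[of "B x" x] by (simp add: sums_iff)
    qed
    show "B (B x) = I_op X2 L \<mu> x" for x
      using pos by (intro coefficients_eqI) (simp add: B I_op_coefficient[OF assms] less_imp_le)
  qed simp
  moreover have "C = B" if C: "is_positive_sqrt UNIV (I_op X2 L \<mu>) UNIV C" for C
  proof
    fix x
    have "I_op X2 L \<mu> (\<phi> k) = (1 / (1 + \<mu>\<^sup>2 * lam k)) *\<^sub>R \<phi> k" for k
      by (intro coefficients_eqI) (simp add: I_op_coefficient[OF assms] inner_basis)
    then have "C (\<phi> k) = sqrt (1 / (1 + \<mu>\<^sup>2 * lam k)) *\<^sub>R \<phi> k" for k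
      using positive_sqrt_eigenvector(2)[OF C UNIV_I] pos[of k] by simp
    moreover have "self_adjoint_op UNIV C"
      using C by (simp add: is_positive_sqrt_def)
    ultimately have "C x \<bullet> \<phi> k = sqrt (1 / (1 + \<mu>\<^sup>2 * lam k)) * (x \<bullet> \<phi> k)" for k
      using self_adjoint_coefficient[of UNIV C k "\<lambda>k. sqrt (1 / (1 + \<mu>\<^sup>2 * lam k))" x] by simp
    then show "C x = B x"
      by (intro coefficients_eqI) (simp add: B real_sqrt_divide)
  qed
  ultimately have "I_half X2 L \<mu> = B"
    unfolding I_half_def by (rule the_equality)
  then show ?thesis
    by (simp add: B)
qed

lemma sqrt_lam_times_I_multiplier: "sqrt (lam n) * (1 / sqrt (1 + \<mu>\<^sup>2 * lam n)) = freq lam \<mu> n"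
  by (simp add: freq_def real_sqrt_divide)

text \<open>
  The two factors \<open>R\<close> contribute \<open>lam n\<close>, the middle one \<open>1 / sqrt (1 + \<mu>\<^sup>2 * lam n)\<close>. That \<open>R\<close> may be
  applied a second time is due to the smoothing of \<open>I_half\<close>, which makes the product of the outer two
  multipliers the bounded \<open>freq lam \<mu>\<close>.
\<close>

lemma diagonal_E:
  assumes "\<mu> > 0"
  shows "diagonal_on X1 UNIV (E_op X2 L R \<mu>) (\<lambda>n. sqrt (lam n) * freq lam \<mu> n)"
  unfolding diagonal_on_def
proof
  fix x assume "x \<in> X1"
  let ?y = "I_half X2 L \<mu> (R x)"
  have y: "sqrt (lam n) * (?y \<bullet> \<phi> n) = freq lam \<mu> n * (R x \<bullet> \<phi> n)" for n
    by (simp add: I_half_coefficient[OF assms] flip: sqrt_lam_times_I_multiplier)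
  have "?y \<in> X1"
    unfolding X1_iff y by (rule summable_square_mult[OF summable_coefficients Bseq_freq[OF assms]])
  then show "E_op X2 L R \<mu> x \<in> UNIV \<and>
      (\<forall>n. E_op X2 L R \<mu> x \<bullet> \<phi> n = sqrt (lam n) * freq lam \<mu> n * (x \<bullet> \<phi> n))"
    using y \<open>x \<in> X1\<close> by (simp add: E_op_def R_coefficient)
qed

lemma diagonal_inv_E:
  assumes "\<mu> > 0"
  shows "diagonal_on UNIV X1 (inv_into X1 (E_op X2 L R \<mu>)) (\<lambda>n. 1 / (sqrt (lam n) * freq lam \<mu> n))"
proof (rule diagonal_on_inv_into[OF diagonal_E[OF assms]])
  show "sqrt (lam n) * freq lam \<mu> n \<noteq> 0" for n
    using lam_pos[of n] freq_pos[of \<mu> n] by simp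
  fix y :: 'a
  have "Bseq (\<lambda>n. 1 / sqrt (lam n))"
    using filterlim_compose[OF filterlim_compose[OF tendsto_inverse_0_at_top[OF filterlim_ident] sqrt_at_top] lam_at_top]
    by (intro convergent_imp_Bseq convergentI) (simp add: inverse_eq_divide)
  then have "Bseq (\<lambda>n. 1 / sqrt (lam n) * (1 / freq lam \<mu> n))"
    using Bseq_inverse_freq[OF assms] by (rule Bseq_mult)
  then obtain x where x: "\<And>n. x \<bullet> \<phi> n = 1 / sqrt (lam n) * (1 / freq lam \<mu> n) * (y \<bullet> \<phi> n)"
    by (rule bounded_multiplier) (rule that)
  then have "sqrt (lam n) * (x \<bullet> \<phi> n) = 1 / freq lam \<mu> n * (y \<bullet> \<phi> n)" for n
    using lam_pos[of n] by simp
  then have "x \<in> X1"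
    unfolding X1_iff
    using summable_square_mult[OF summable_coefficients Bseq_inverse_freq[OF assms]] by simp
  with x show "\<exists>x\<in>X1. \<forall>n. x \<bullet> \<phi> n = y \<bullet> \<phi> n / (sqrt (lam n) * freq lam \<mu> n)"
    by auto
qed

lemma diagonal_Q:
  assumes "\<mu> > 0" and "t \<in> Omega lam \<mu>"
  shows "diagonal_on X1 X1 (Q_op X1 R \<phi> lam \<mu> t) (\<lambda>n. 1 / (freq lam \<mu> n * sin (freq lam \<mu> n * t)))"
  unfolding Q_op_def[abs_def] by (rule diagonal_series[OF Bseq_inverse_freq_sin[OF assms]])

lemma diagonal_inv_Q:
  assumes "\<mu> > 0" and "t \<in> Omega lam \<mu>"
  shows "diagonal_on X1 X1 (inv_into X1 (Q_op X1 R \<phi> lam \<mu> t))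
    (\<lambda>n. freq lam \<mu> n * sin (freq lam \<mu> n * t))"
proof -
  have "diagonal_on X1 X1 (inv_into X1 (Q_op X1 R \<phi> lam \<mu> t))
      (\<lambda>n. 1 / (1 / (freq lam \<mu> n * sin (freq lam \<mu> n * t))))"
  proof (rule diagonal_on_inv_into[OF diagonal_Q[OF assms]])
    show "1 / (freq lam \<mu> n * sin (freq lam \<mu> n * t)) \<noteq> 0" for n
      using freq_pos[of \<mu> n] sin_nonzero(1)[OF assms(2)] by simp
    fix y assume "y \<in> X1"
    from multiplier_in_X1[OF this Bseq_freq_sin[OF assms(1), of t]]
    show "\<exists>x\<in>X1. \<forall>n. x \<bullet> \<phi> n = y \<bullet> \<phi> n / (1 / (freq lam \<mu> n * sin (freq lam \<mu> n * t)))"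
      by (metis div_by_1 divide_divide_eq_right mult.commute)
  qed
  then show ?thesis
    by simp
qed

lemma diagonal_P:
  assumes "\<mu> > 0" and "t \<in> Omega lam \<mu>"
  shows "diagonal_on X1 X1 (P_op X1 R \<phi> lam \<mu> t)
    (\<lambda>n. - cos (freq lam \<mu> n * t) / (freq lam \<mu> n * sin (freq lam \<mu> n * t)))"
proof -
  let ?m = "\<lambda>n. (- 1) / (freq lam \<mu> n * tan (freq lam \<mu> n * t))"
  have m: "?m = (\<lambda>n. - cos (freq lam \<mu> n * t) / (freq lam \<mu> n * sin (freq lam \<mu> n * t)))"
    \<comment> \<open>This also holds at zeros of the cosine, where division by zero makes both sides vanish.\<close>
    by (simp add: tan_def)
  have "Bseq (\<lambda>n. - cos (freq lam \<mu> n * t))"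
    by (intro BseqI'[of _ 1]) simp
  from Bseq_mult[OF this Bseq_inverse_freq_sin[OF assms]] have "Bseq ?m"
    unfolding m by simp
  from diagonal_series[OF this] show ?thesis
    unfolding P_op_def[abs_def] m .
qed

section \<open>Rotation of the modes\<close>

text \<open>
  In the coordinates \<open>(sqrt (lam n) * (x \<bullet> \<phi> n), p \<bullet> \<phi> n)\<close> of the \<open>n\<close>-th mode of \<open>(x, p)\<close> this is
  the clockwise rotation by \<open>\<theta> n\<close>.
\<close>

definition rotates :: "(nat \<Rightarrow> real) \<Rightarrow> 'a \<times> 'a \<Rightarrow> 'a \<times> 'a \<Rightarrow> bool" where
  "rotates \<theta> v w \<longleftrightarrow> fst w \<in> X1 \<and> (\<forall>n.
     fst w \<bullet> \<phi> n = cos (\<theta> n) * (fst v \<bullet> \<phi> n) + sin (\<theta> n) / sqrt (lam n) * (snd v \<bullet> \<phi> n) \<and>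
     snd w \<bullet> \<phi> n = - sqrt (lam n) * sin (\<theta> n) * (fst v \<bullet> \<phi> n) + cos (\<theta> n) * (snd v \<bullet> \<phi> n))"

text \<open>
  In the lower left block \<open>I - (Q\<inverse> P)\<^sup>2\<close> has the multiplier \<open>1 - cos\<^sup>2 = sin\<^sup>2\<close>, so that one sine
  survives the division by the sine in \<open>Q\<close>; in the other blocks every factor \<open>\<omega>\<^sub>n\<close> and every
  denominator \<open>sin\<close> cancels directly.
\<close>

lemma prototype_rotates:
  assumes "\<mu> > 0" and "t \<in> Omega lam \<mu>" and "x \<in> X1"
  shows "rotates (\<lambda>n. freq lam \<mu> n * t) (x, p) (U_proto X2 L X1 R \<phi> lam \<mu> t (x, p))"
proof -
  define P where "P = P_op X1 R \<phi> lam \<mu> t"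
  define Q where "Q = Q_op X1 R \<phi> lam \<mu> t"
  define Qinv where "Qinv = inv_into X1 Q"
  define E where "E = E_op X2 L R \<mu>"
  define Einv where "Einv = inv_into X1 E"
  let ?w = "freq lam \<mu>"
  have P: "P z \<in> X1" "P z \<bullet> \<phi> n = - cos (?w n * t) / (?w n * sin (?w n * t)) * (z \<bullet> \<phi> n)" if "z \<in> X1" for z n
    using diagonal_P[OF assms(1,2)] that unfolding P_def diagonal_on_def by blast+
  have Q: "Q z \<in> X1" "Q z \<bullet> \<phi> n = 1 / (?w n * sin (?w n * t)) * (z \<bullet> \<phi> n)" if "z \<in> X1" for z n
    using diagonal_Q[OF assms(1,2)] that unfolding Q_def diagonal_on_def by blast+
  have Qinv: "Qinv z \<in> X1" "Qinv z \<bullet> \<phi> n = ?w n * sin (?w n * t) * (z \<bullet> \<phi> n)" if "z \<in> X1" for z n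
    using diagonal_inv_Q[OF assms(1,2)] that unfolding Qinv_def Q_def diagonal_on_def by blast+
  have E: "E z \<bullet> \<phi> n = sqrt (lam n) * ?w n * (z \<bullet> \<phi> n)" if "z \<in> X1" for z n
    using diagonal_E[OF assms(1)] that unfolding E_def diagonal_on_def by blast
  have Einv: "Einv z \<in> X1" "Einv z \<bullet> \<phi> n = 1 / (sqrt (lam n) * ?w n) * (z \<bullet> \<phi> n)" for z n
    using diagonal_inv_E[OF assms(1)] unfolding Einv_def E_def diagonal_on_def by blast+
  have U: "U_proto X2 L X1 R \<phi> lam \<mu> t (x, p) = (- Qinv (P x) + Qinv (Einv p),
      - E (Q (x - Qinv (P (Qinv (P x))))) + (- E (P (Qinv (Einv p)))))"
    by (simp add: U_proto_def Let_def P_def Q_def Qinv_def E_def Einv_def)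
  have nz: "?w n \<noteq> 0" "sin (?w n * t) \<noteq> 0" "lam n > 0" for n
    using freq_pos[of \<mu> n] sin_nonzero(1)[OF assms(2)] lam_pos by auto
  note in_X1 = P(1) Q(1) Qinv(1) Einv(1) subspace_diff[OF subspace_X1] \<open>x \<in> X1\<close>
  have fst_in: "- Qinv (P x) + Qinv (Einv p) \<in> X1"
    using subspace_diff[OF subspace_X1, of "Qinv (Einv p)" "Qinv (P x)"] by (simp add: in_X1)
  have fst_coef: "(- Qinv (P x) + Qinv (Einv p)) \<bullet> \<phi> n
      = cos (?w n * t) * (x \<bullet> \<phi> n) + sin (?w n * t) / sqrt (lam n) * (p \<bullet> \<phi> n)" for n
    using nz[of n] by (simp add: inner_add_left inner_diff_left in_X1 P(2) Qinv(2) Einv(2))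
  have P2: "(x - Qinv (P (Qinv (P x)))) \<bullet> \<phi> n = (sin (?w n * t))\<^sup>2 * (x \<bullet> \<phi> n)" for n
  proof -
    have "(x - Qinv (P (Qinv (P x)))) \<bullet> \<phi> n = x \<bullet> \<phi> n - (cos (?w n * t))\<^sup>2 * (x \<bullet> \<phi> n)"
      using nz[of n] by (simp add: inner_diff_left in_X1 P(2) Qinv(2) power2_eq_square)
    then show ?thesis
      by (simp add: sin_squared_eq left_diff_distrib)
  qed
  have snd1: "E (Q (x - Qinv (P (Qinv (P x))))) \<bullet> \<phi> n = sqrt (lam n) * sin (?w n * t) * (x \<bullet> \<phi> n)" for n
    using nz[of n] P2[of n] by (simp add: in_X1 E Q(2) power2_eq_square)
  have snd2: "E (P (Qinv (Einv p))) \<bullet> \<phi> n = - cos (?w n * t) * (p \<bullet> \<phi> n)" for n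
    using nz[of n] by (simp add: in_X1 E P(2) Qinv(2) Einv(2))
  show ?thesis
    unfolding rotates_def U using fst_in fst_coef snd1 snd2 by (simp add: inner_add_left inner_diff_left)
qed

section \<open>The wave group in coordinates\<close>

lemma normY_eq: "normY R v = norm (R (fst v), snd v)"
  by (simp add: normY_def innerY_def inner1_def norm_eq_sqrt_inner)

lemma coefficient_le_normY:
  assumes "fst v \<in> X1"
  shows "\<bar>fst v \<bullet> \<phi> n\<bar> \<le> normY R v / sqrt (lam n)" and "\<bar>snd v \<bullet> \<phi> n\<bar> \<le> normY R v"
proof -
  have "\<bar>sqrt (lam n) * (fst v \<bullet> \<phi> n)\<bar> \<le> norm (R (fst v))"
    using Cauchy_Schwarz_ineq2[of "R (fst v)" "\<phi> n"] assms by (simp add: R_coefficient norm_basis)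
  also have "\<dots> \<le> normY R v"
    unfolding normY_eq by (metis fst_conv norm_fst_le)
  finally show "\<bar>fst v \<bullet> \<phi> n\<bar> \<le> normY R v / sqrt (lam n)"
    using lam_pos[of n] by (simp add: abs_mult pos_le_divide_eq mult.commute)
  have "\<bar>snd v \<bullet> \<phi> n\<bar> \<le> norm (snd v)"
    using Cauchy_Schwarz_ineq2[of "snd v" "\<phi> n"] by (simp add: norm_basis)
  also have "\<dots> \<le> normY R v"
    unfolding normY_eq by (metis snd_conv norm_snd_le)
  finally show "\<bar>snd v \<bullet> \<phi> n\<bar> \<le> normY R v" .
qed

text \<open>
  Coefficients are continuous in the energy norm. This transfers both the derivative of the orbit and
  the density argument to single modes.
\<close>

lemma coefficient_tendsto:
  assumes lim: "((\<lambda>h. normY R (v h - z)) \<longlongrightarrow> 0) F"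
    and v: "\<And>h. v h \<in> X1 \<times> UNIV" and z: "z \<in> X1 \<times> UNIV"
  shows "((\<lambda>h. fst (v h) \<bullet> \<phi> n) \<longlongrightarrow> fst z \<bullet> \<phi> n) F"
    and "((\<lambda>h. snd (v h) \<bullet> \<phi> n) \<longlongrightarrow> snd z \<bullet> \<phi> n) F"
proof -
  have "fst (v h - z) \<in> X1" for h
    using v[of h] z subspace_diff[OF subspace_X1] by auto
  note le = coefficient_le_normY[OF this]
  have "((\<lambda>h. normY R (v h - z) / sqrt (lam n)) \<longlongrightarrow> 0) F"
    using tendsto_divide[OF lim tendsto_const, of "sqrt (lam n)"] lam_pos[of n] by simp
  then have "((\<lambda>h. fst (v h) \<bullet> \<phi> n - fst z \<bullet> \<phi> n) \<longlongrightarrow> 0) F"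
    by (rule Lim_null_comparison[rotated]) (use le(1) in \<open>simp add: inner_diff_left\<close>)
  then show "((\<lambda>h. fst (v h) \<bullet> \<phi> n) \<longlongrightarrow> fst z \<bullet> \<phi> n) F"
    by (rule LIM_zero_cancel)
  have "((\<lambda>h. snd (v h) \<bullet> \<phi> n - snd z \<bullet> \<phi> n) \<longlongrightarrow> 0) F"
    using lim by (rule Lim_null_comparison[rotated]) (use le(2) in \<open>simp add: inner_diff_left\<close>)
  then show "((\<lambda>h. snd (v h) \<bullet> \<phi> n) \<longlongrightarrow> snd z \<bullet> \<phi> n) F"
    by (rule LIM_zero_cancel)
qed

text \<open>
  For initial values in the domain of the generator the orbit stays in the domain, so its coefficients
  are differentiable and satisfy \<open>a' = b\<close>, \<open>b' = - lam n * a\<close>. Every other initial value is the limit in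
  energy norm of its spectral truncations, which lie in the domain, and \<open>U t\<close> is bounded.
\<close>

lemma group_rotates:
  assumes group: "C0_group (X1 \<times> UNIV) (normY R) U"
    and gen: "generated_by (X1 \<times> UNIV) (normY R) U (X2 \<times> X1) (wave_op L)"
    and v: "v \<in> X1 \<times> UNIV"
  shows "rotates (\<lambda>n. sqrt (lam n) * t) v (U t v)"
proof -
  let ?V = "X1 \<times> (UNIV :: 'a set)"
  have V: "subspace ?V"
    using subspace_X1 by (intro subspace_Times) auto
  note lin = C0_group_linear[OF group] and U = C0_group_closed[OF group]
  \<comment> \<open>On the domain of the generator the coefficients can be differentiated in time.\<close>
  have smooth: "fst (U t d) \<bullet> \<phi> n = cos (sqrt (lam n) * t) * (fst d \<bullet> \<phi> n)
        + sin (sqrt (lam n) * t) / sqrt (lam n) * (snd d \<bullet> \<phi> n) \<and>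
      snd (U t d) \<bullet> \<phi> n = - sqrt (lam n) * sin (sqrt (lam n) * t) * (fst d \<bullet> \<phi> n)
        + cos (sqrt (lam n) * t) * (snd d \<bullet> \<phi> n)"
    if d: "d \<in> X2 \<times> X1" for d n
  proof -
    have d_V: "d \<in> ?V"
      using d X2_subset_X1 by auto
    let ?q = "\<lambda>s h. (1 / h) *\<^sub>R (U h (U s d) - U s d)"
    have q: "?q s h \<in> ?V" for s h
      by (intro subspace_scale subspace_diff V U d_V)
    have Ud: "U s d \<in> X2 \<times> X1" for s
      using generator_domain_invariant[OF V group gen _ d] by (simp add: normY_eq)
    have AUd: "wave_op L (U s d) \<in> ?V" for s
      using Ud[of s] by (auto simp: wave_op_def)
    have "((\<lambda>h. normY R (?q s h - wave_op L (U s d))) \<longlongrightarrow> 0) (at 0)" for s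
      using Ud[of s] by (simp add: generated_by_iff[OF gen U[OF d_V] AUd])
    note lim = coefficient_tendsto[OF this q AUd]
    have shift: "U h (U s d) = U (s + h) d" for s h
      using C0_group_add[OF group d_V, of h s] by (simp add: add.commute)
    have "((\<lambda>s. fst (U s d) \<bullet> \<phi> n) has_real_derivative snd (U s d) \<bullet> \<phi> n) (at s)" for s
      using lim(1)[of s n] by (simp add: DERIV_def shift inner_diff_left wave_op_def divide_inverse mult.commute)
    moreover have "((\<lambda>s. snd (U s d) \<bullet> \<phi> n) has_real_derivative
        - ((sqrt (lam n))\<^sup>2 * (fst (U s d) \<bullet> \<phi> n))) (at s)" for s
      using lim(2)[of s n] lam_pos[of n] Ud[of s]
      by (auto simp: DERIV_def shift inner_diff_left wave_op_def divide_inverse mult.commute L_coefficient)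
    ultimately show ?thesis
      using harmonic_oscillator[of "sqrt (lam n)" "\<lambda>s. fst (U s d) \<bullet> \<phi> n" "\<lambda>s. snd (U s d) \<bullet> \<phi> n" t]
        lam_pos[of n] C0_group_zero[OF group d_V] by simp
  qed
  define d where "d m = (\<Sum>n<m. (fst v \<bullet> \<phi> n) *\<^sub>R \<phi> n, \<Sum>n<m. (snd v \<bullet> \<phi> n) *\<^sub>R \<phi> n)" for m
  have d: "d m \<in> X2 \<times> X1" for m
    using partial_sum_in_X1 partial_sum_in_X2 by (simp add: d_def)
  have d_V: "d m \<in> ?V" for m
    using partial_sum_in_X1 by (simp add: d_def)
  have lim: "(\<lambda>m. normY R (d m - v)) \<longlonglongrightarrow> 0"
  proof -
    have R_eq: "R (fst (d m - v)) = (\<Sum>n<m. (R (fst v) \<bullet> \<phi> n) *\<^sub>R \<phi> n) - R (fst v)" for m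
      using v partial_sum_in_X1 by (auto simp: d_def R_diff R_partial_sum)
    have snd_eq: "snd (d m - v) = (\<Sum>n<m. (snd v \<bullet> \<phi> n) *\<^sub>R \<phi> n) - snd v" for m
      by (simp add: d_def)
    have le: "normY R (d m - v) \<le> norm ((\<Sum>n<m. (R (fst v) \<bullet> \<phi> n) *\<^sub>R \<phi> n) - R (fst v))
        + norm ((\<Sum>n<m. (snd v \<bullet> \<phi> n) *\<^sub>R \<phi> n) - snd v)" for m
      unfolding normY_eq R_eq snd_eq by (rule norm_Pair_le)
    have "(\<lambda>m. norm ((\<Sum>n<m. (x \<bullet> \<phi> n) *\<^sub>R \<phi> n) - x)) \<longlonglongrightarrow> 0" for x
      using fourier_series[of x] unfolding sums_def by (rule tendsto_norm_zero[OF LIM_zero])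
    from this[of "R (fst v)"] this[of "snd v"] have "(\<lambda>m. norm ((\<Sum>n<m. (R (fst v) \<bullet> \<phi> n) *\<^sub>R \<phi> n) - R (fst v))
        + norm ((\<Sum>n<m. (snd v \<bullet> \<phi> n) *\<^sub>R \<phi> n) - snd v)) \<longlonglongrightarrow> 0"
      by (rule tendsto_add_zero)
    then show ?thesis
      by (rule Lim_null_comparison[rotated]) (use le in \<open>simp add: normY_eq\<close>)
  qed
  obtain K where K: "\<And>w. w \<in> ?V \<Longrightarrow> normY R (U t w) \<le> K * normY R w"
    using C0_group_bounded[OF group, of t] by auto
  have "U t (d m - v) = U t (d m) - U t v" for m
    by (rule linear_op_diff[OF lin d_V v])
  then have "normY R (U t (d m) - U t v) \<le> K * normY R (d m - v)" for m
    using K[OF subspace_diff[OF V d_V v]] by metis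
  then have "(\<lambda>m. normY R (U t (d m) - U t v)) \<longlonglongrightarrow> 0"
    by (intro Lim_null_comparison[OF _ tendsto_mult_right_zero[OF lim, of K]]) (auto simp: normY_eq)
  note Ulim = coefficient_tendsto[OF this U[OF d_V] U[OF v]]
  note dlim = coefficient_tendsto[OF lim d_V v]
  have "fst (U t v) \<bullet> \<phi> n = cos (sqrt (lam n) * t) * (fst v \<bullet> \<phi> n)
      + sin (sqrt (lam n) * t) / sqrt (lam n) * (snd v \<bullet> \<phi> n)" for n
  proof (rule LIMSEQ_unique[OF Ulim(1)])
    show "(\<lambda>m. fst (U t (d m)) \<bullet> \<phi> n) \<longlonglongrightarrow> cos (sqrt (lam n) * t) * (fst v \<bullet> \<phi> n)
      + sin (sqrt (lam n) * t) / sqrt (lam n) * (snd v \<bullet> \<phi> n)"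
      unfolding conjunct1[OF smooth[OF d]] by (intro tendsto_add tendsto_mult_left dlim)
  qed
  moreover have "snd (U t v) \<bullet> \<phi> n = - sqrt (lam n) * sin (sqrt (lam n) * t) * (fst v \<bullet> \<phi> n)
      + cos (sqrt (lam n) * t) * (snd v \<bullet> \<phi> n)" for n
  proof (rule LIMSEQ_unique[OF Ulim(2)])
    show "(\<lambda>m. snd (U t (d m)) \<bullet> \<phi> n) \<longlonglongrightarrow> - sqrt (lam n) * sin (sqrt (lam n) * t) * (fst v \<bullet> \<phi> n)
      + cos (sqrt (lam n) * t) * (snd v \<bullet> \<phi> n)"
      unfolding conjunct2[OF smooth[OF d]] by (intro tendsto_add tendsto_mult_left dlim)
  qed
  ultimately show ?thesis
    using U[OF v, of t] unfolding rotates_def by auto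
qed

section \<open>Convergence of rotations\<close>

text \<open>
  The planar identity behind this is
  \<open>(cos \<alpha> - cos \<beta>)\<^sup>2 + (sin \<alpha> - sin \<beta>)\<^sup>2 = 2 - 2 cos (\<alpha> - \<beta>)\<close>; Parseval's equation sums it over the
  modes.
\<close>

lemma normY_rotates_diff:
  assumes v: "fst v \<in> X1" and w: "rotates \<theta> v w" and w': "rotates \<theta>' v w'"
  shows "(\<lambda>n. (2 - 2 * cos (\<theta> n - \<theta>' n)) * ((R (fst v) \<bullet> \<phi> n)\<^sup>2 + (snd v \<bullet> \<phi> n)\<^sup>2))
    sums (normY R (w - w'))\<^sup>2"
proof -
  let ?a = "\<lambda>n. sqrt (lam n) * (fst v \<bullet> \<phi> n)" and ?b = "\<lambda>n. snd v \<bullet> \<phi> n"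
  have scaled: "sqrt (lam n) * (fst u \<bullet> \<phi> n) = cos (\<alpha> n) * ?a n + sin (\<alpha> n) * ?b n"
    if "rotates \<alpha> v u" for \<alpha> u n
    using that[unfolded rotates_def, THEN conjunct2, THEN spec, THEN conjunct1] lam_pos[of n]
    by (simp add: distrib_left)
  have in_X1: "fst (w - w') \<in> X1"
    using w w' subspace_diff[OF subspace_X1] by (simp add: rotates_def)
  have cR: "R (fst (w - w')) \<bullet> \<phi> n
      = (cos (\<theta> n) - cos (\<theta>' n)) * ?a n + (sin (\<theta> n) - sin (\<theta>' n)) * ?b n" for n
    using scaled[OF w, of n] scaled[OF w', of n] R_coefficient[OF in_X1, of n]
    by (simp add: inner_diff_left algebra_simps)
  have cS: "snd (w - w') \<bullet> \<phi> n
      = (cos (\<theta> n) - cos (\<theta>' n)) * ?b n - (sin (\<theta> n) - sin (\<theta>' n)) * ?a n" for n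
    using w w' unfolding rotates_def by (simp add: inner_diff_left algebra_simps)
  have "(normY R (w - w'))\<^sup>2 = R (fst (w - w')) \<bullet> R (fst (w - w')) + snd (w - w') \<bullet> snd (w - w')"
    unfolding normY_eq power2_norm_eq_inner by (simp only: inner_Pair fst_conv snd_conv)
  moreover have "(R (fst (w - w')) \<bullet> \<phi> n) * (R (fst (w - w')) \<bullet> \<phi> n)
      + (snd (w - w') \<bullet> \<phi> n) * (snd (w - w') \<bullet> \<phi> n)
      = (2 - 2 * cos (\<theta> n - \<theta>' n)) * ((R (fst v) \<bullet> \<phi> n)\<^sup>2 + (snd v \<bullet> \<phi> n)\<^sup>2)" for n
    unfolding cR cS cos_diff R_coefficient[OF v]
    using sin_cos_squared_add[of "\<theta> n"] sin_cos_squared_add[of "\<theta>' n"] by algebra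
  ultimately show ?thesis
    using sums_add[OF parseval[of "R (fst (w - w'))" "R (fst (w - w'))"]
        parseval[of "snd (w - w')" "snd (w - w')"]] by simp
qed

text \<open>
  Tannery's theorem with the energies of the modes of \<open>v\<close>, times four, as majorant.
\<close>

lemma rotations_converge:
  assumes v: "fst v \<in> X1"
    and w: "\<And>i. rotates (\<theta> i) v (w i)" and w': "rotates \<theta>' v w'"
    and lim: "\<And>n. (\<lambda>i. \<theta> i n) \<longlonglongrightarrow> \<theta>' n"
  shows "(\<lambda>i. normY R (w i - w')) \<longlonglongrightarrow> 0"
proof -
  define r where "r n = (R (fst v) \<bullet> \<phi> n)\<^sup>2 + (snd v \<bullet> \<phi> n)\<^sup>2" for n
  have r: "summable r" "\<And>n. r n \<ge> 0"
    unfolding r_def[abs_def] by (auto intro: summable_add summable_coefficients)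
  let ?f = "\<lambda>n i. (2 - 2 * cos (\<theta> i n - \<theta>' n)) * r n"
  have "(\<lambda>i. \<Sum>n. ?f n i) \<longlonglongrightarrow> (\<Sum>n. 0)"
  proof (rule conjunct2[OF conjunct2[OF tannerys_theorem]])
    show "(\<lambda>i. ?f n i) \<longlonglongrightarrow> 0" for n
    proof -
      have "(\<lambda>i. ?f n i) \<longlonglongrightarrow> (2 - 2 * cos (\<theta>' n - \<theta>' n)) * r n"
        by (intro tendsto_intros lim)
      then show ?thesis
        by simp
    qed
    have "norm (?f n i) \<le> 4 * r n" for n i
    proof -
      have "\<bar>2 - 2 * cos (\<theta> i n - \<theta>' n)\<bar> \<le> 4"
        using abs_cos_le_one[of "\<theta> i n - \<theta>' n"] by linarith
      then show ?thesis
        using r(2)[of n] by (simp add: abs_mult mult_right_mono)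
    qed
    then show "\<forall>\<^sub>F (n, i) in sequentially \<times>\<^sub>F sequentially. norm (?f n i) \<le> 4 * r n"
      by (intro always_eventually) auto
    show "summable (\<lambda>n. 4 * r n)"
      using r(1) by (rule summable_mult)
  qed simp
  moreover have "(\<Sum>n. ?f n i) = (normY R (w i - w'))\<^sup>2" for i
    using normY_rotates_diff[OF v w w'] by (simp add: sums_iff r_def)
  ultimately have "(\<lambda>i. (normY R (w i - w'))\<^sup>2) \<longlonglongrightarrow> 0"
    by simp
  then show ?thesis
    by simp
qed

end

theorem theorem4p9:
  fixes X2 X1 :: "'a::{real_inner, complete_space} set"
    and L R :: "'a \<Rightarrow> 'a"
    and \<phi> :: "nat \<Rightarrow> 'a"
    and lam :: "nat \<Rightarrow> real"
    and U :: "real \<Rightarrow> 'a \<times> 'a \<Rightarrow> 'a \<times> 'a"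
    and \<mu> :: "nat \<Rightarrow> real"
    and t :: real
  assumes "self_adjoint_op X2 L" and "positive_op X2 L" and "unbounded_op X2 L"
    and "has_compact_inverse X2 L"
    and "is_positive_sqrt X2 L X1 R"
    and "orthonormal_basis \<phi>"
    and "\<And>n. \<phi> n \<in> X2 \<and> L (\<phi> n) = lam n *\<^sub>R \<phi> n"
    and "0 < lam 0" and "mono lam" and "filterlim lam at_top sequentially"
    and "C0_group (X1 \<times> UNIV) (normY R) U"
    and "generated_by (X1 \<times> UNIV) (normY R) U (X2 \<times> X1) (wave_op L)"
    and "\<And>i. \<mu> i > 0" and "\<mu> \<longlonglongrightarrow> 0"
    and "t \<in> Omega lam 0 \<inter> (\<Inter>i. Omega lam (\<mu> i))"
  shows "\<forall>x\<in>X1. \<forall>p.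
    (\<lambda>i. normY R (U_proto X2 L X1 R \<phi> lam (\<mu> i) t (x, p) - U t (x, p))) \<longlonglongrightarrow> 0"
proof (intro ballI allI)
  fix x p assume x: "x \<in> X1"
  have lam_pos: "lam n > 0" for n
    using \<open>0 < lam 0\<close> monoD[OF \<open>mono lam\<close>, of 0 n] by simp
  interpret wave_system \<phi> X2 L X1 R lam
    by unfold_locales (fact assms lam_pos)+
  have "rotates (\<lambda>n. freq lam (\<mu> i) n * t) (x, p) (U_proto X2 L X1 R \<phi> lam (\<mu> i) t (x, p))" for i
    using assms(13,15) x by (intro prototype_rotates) auto
  moreover have "rotates (\<lambda>n. sqrt (lam n) * t) (x, p) (U t (x, p))"
    using x by (intro group_rotates[OF assms(11,12)]) simp
  moreover have "(\<lambda>i. freq lam (\<mu> i) n * t) \<longlonglongrightarrow> sqrt (lam n) * t" for n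
    by (intro tendsto_intros freq_tendsto_sqrt assms(14))
  ultimately show "(\<lambda>i. normY R (U_proto X2 L X1 R \<phi> lam (\<mu> i) t (x, p) - U t (x, p))) \<longlonglongrightarrow> 0"
    using x by (intro rotations_converge[of "(x, p)"]) auto
qed

end
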